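(* Let $\lambda$ be a partition as in the context, with associated polynomials $\hat h(n,x)$, differential operators $A,B$, stabilizer ring $\mathcal S$, and, for $f\in\mathcal S$, difference operator $\hat\Delta_f$ acting in the variable $n$. Then for all $f\in\mathcal S$, $$\hat\Delta_f\,\hat h(n,x)=f(x)\,\hat h(n,x)\qquad\text{for all integers } n\ge N-\ell .$$
   Context: Hermite polynomials: $h(n,x)=H_n(x)$ is the physicists' Hermite polynomial of degree $n\ge 0$ (so $h(0,x)=1$, $h(1,x)=2x$, $2x\,h(n,x)=h(n+1,x)+2n\,h(n-1,x)$, $h(n,x)'=2n\,h(n-1,x)$). $\mathrm{Wr}$ is the Wronskian determinant with respect to $x$; the empty Wronskian is $1$. $\partial=\partial/\partial x$, and $\mathbb C[x,\partial]$ is the ring of differential operators with polynomial coefficients. Partition data (fixed): $\ell\ge1$, positive integers $\lambda_1\le\dots\le\lambda_\ell$, $N=\sum_i\lambda_i$, $k_i=\lambda_i+i-1$, $K=\{k_1,\dots,k_\ell\}$ (so $k_1<\dots<k_\ell$ and $N\ge\ell$). Put $\eta(x)=\mathrm{Wr}[h(k_1,x),\dots,h(k_\ell,x)]$, and define differential operators of order $\ell$ by $$A(y)=\mathrm{Wr}[h(k_1,x),\dots,h(k_\ell,x),y],\qquad B(y)=(-1)^{\lfloor \ell/2\rfloor}e^{x^2}\eta^{-\ell}\,\mathrm{Wr}[\tilde h_1,\dots,\tilde h_\ell,e^{-x^2}y],$$ where $\tilde h_j$ is the Wronskian of $h(k_1,x),\dots,h(k_\ell,x)$ with $h(k_j,x)$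 omitted. Exceptional Hermite polynomials: $\hat h(n,x)=A(h(n+\ell-N,x))$ for integers $n\ge N-\ell$; this is zero if $n+\ell-N\in K$ and has degree $n$ otherwise. Let $\mathcal I=\{n\in\mathbb N_0: n\ge N-\ell,\ n+\ell-N\notin K\}$, $\mathcal U=\operatorname{span}_{\mathbb C}\{\hat h(n,x):n\in\mathcal I\}\subset\mathbb C[x]$, and $$\mathcal S=\{f\in\mathbb C[x]: f(x)\hat h(n,x)\in\mathcal U\text{ for all } n\}.$$ Difference operators: $\Theta$ is the shift $(\Theta g)(n)=g(n+1)$. On functions $g$ of $n\in\mathbb N_0$ put $(\Delta g)(n)=\tfrac12 g(n+1)+n\,g(n-1)$ and $(\Gamma g)(n)=2n\,g(n-1)$ (with $n\,g(n-1)=0$ at $n=0$), i.e. $\Delta=\frac12\Theta+n\circ\Theta^{-1}$, $\Gamma=2n\circ\Theta^{-1}$. Let $\mathbb C[\Delta,\Gamma]$ be the (noncommutative) ring of operators generated by $\Delta,\Gamma$, and let $\flat:\mathbb C[x,\partial]\to\mathbb C[\Delta,\Gamma]$ be the linear map with $\flat(x^i\partial^j)=\Gamma^j\Delta^i$. Set $\pi(n)=\prod_{i=1}^\ell(-2n+2k_i)$. For $f\in\mathcal S$ (here $f$ also denotes multiplication by $f(x)$), the operator $B\circ f\circ A$ belongs to $\mathbb C[x,\partial]$, and one defines $$\hat\Delta_f=\Theta^{\ell-N}\circ\flat(B\circ f\circ A)\circ\frac1{\pi(n)}\circ\Theta^{N-\ell}.$$ Here $\Theta^{N-\ell}$ takes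 functions of $n\ge N-\ell$ to functions of $n\ge 0$ and $\Theta^{\ell-N}$ is its inverse. In applying $\hat\Delta_f$ to $\hat h(n,x)$, the function $\frac{1}{\pi(n)}\hat h(n+N-\ell,x)$ of $n\in\mathbb N_0$ is taken to be $0$ at those $n\in K$ (where both $\pi(n)=0$ and $\hat h(n+N-\ell,x)=0$). *)

theory Defs
  imports
    "HOL-Analysis.Analysis"
    "HOL-Library.Function_Algebras"
    "HOL-Computational_Algebra.Polynomial"
    "Jordan_Normal_Form.Determinant"
begin

hide_const (open) module.smult

fun hermite :: "nat \<Rightarrow> complex poly" where
  "hermite 0 = 1"
| "hermite (Suc 0) = [:0, 2:]"
| "hermite (Suc (Suc n)) = [:0, 2:] * hermite (Suc n) - smult (of_nat (2 * Suc n)) (hermite n)"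

text \<open>
  The Wronskian is taken in an arbitrary commutative ring with a derivation \<open>D\<close>. It is used with
  \<open>D = pderiv\<close> on \<open>complex poly\<close>, and with \<open>D = deriv\<close> on the ring \<open>complex \<Rightarrow> complex\<close> of functions
  with pointwise operations. The Wronskian of the empty list is the determinant of the
  \<open>0\<close> by \<open>0\<close> matrix, which is \<open>1\<close>.
\<close>
definition wronskian :: "('a \<Rightarrow> 'a) \<Rightarrow> 'a list \<Rightarrow> 'a::comm_ring_1" where
  "wronskian D fs = det (mat (length fs) (length fs) (\<lambda>(i, j). (D ^^ i) (fs ! j)))"

lemma wronskian_Nil: "wronskian D [] = 1"
  by (simp add: wronskian_def)

text \<open>
  A partition is the list \<open>lam = [\<lambda>\<^sub>1, \<dots>, \<lambda>\<^sub>l]\<close>. List positions start at \<open>0\<close>, so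
  \<open>k\<^sub>i = \<lambda>\<^sub>i + i - 1\<close> becomes \<open>lam ! i + i\<close>.
\<close>
definition kseq :: "nat list \<Rightarrow> nat list" where
  "kseq lam = map (\<lambda>i. lam ! i + i) [0..<length lam]"

definition eta :: "nat list \<Rightarrow> complex poly" where
  "eta lam = wronskian pderiv (map hermite (kseq lam))"

definition A_op :: "nat list \<Rightarrow> complex poly \<Rightarrow> complex poly" where
  "A_op lam y = wronskian pderiv (map hermite (kseq lam) @ [y])"

definition htilde :: "nat list \<Rightarrow> nat \<Rightarrow> complex poly" where
  "htilde lam j =
     wronskian pderiv (map hermite (take j (kseq lam) @ drop (Suc j) (kseq lam)))"

text \<open>
  \<open>B\<close> has rational coefficients with poles at zeros of \<open>\<eta>\<close> only; the value of \<open>B_op lam y x\<close> is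
  meaningful when \<open>poly (eta lam) x \<noteq> 0\<close>.
\<close>
definition B_op :: "nat list \<Rightarrow> (complex \<Rightarrow> complex) \<Rightarrow> complex \<Rightarrow> complex" where
  "B_op lam y x =
     (- 1) ^ (length lam div 2) * exp (x\<^sup>2) / poly (eta lam) x ^ length lam *
     wronskian deriv (map (\<lambda>j. poly (htilde lam j)) [0..<length lam] @ [\<lambda>z. exp (- (z\<^sup>2)) * y z]) x"

text \<open>
  Since the length of a partition does not exceed its sum \<open>N\<close>, all integers \<open>n \<ge> N - l\<close> are natural
  numbers. For these the subtraction below does not truncate; the values at \<open>n < N - l\<close> are
  never used.
\<close>
definition hhat :: "nat list \<Rightarrow> nat \<Rightarrow> complex poly" where
  "hhat lam n = A_op lam (hermite (n + length lam - sum_list lam))"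

definition index_set :: "nat list \<Rightarrow> nat set" where
  "index_set lam =
     {n. sum_list lam - length lam \<le> n \<and> n + length lam - sum_list lam \<notin> set (kseq lam)}"

interpretation poly_vs: vector_space "smult :: complex \<Rightarrow> complex poly \<Rightarrow> complex poly"
  by unfold_locales (simp_all add: smult_add_left smult_add_right)

definition U_space :: "nat list \<Rightarrow> complex poly set" where
  "U_space lam = poly_vs.span (hhat lam ` index_set lam)"

definition stabilizer :: "nat list \<Rightarrow> complex poly set" where
  "stabilizer lam = {f. \<forall>n \<ge> sum_list lam - length lam. f * hhat lam n \<in> U_space lam}"

text \<open>
  An element \<open>\<Sum>\<^sub>j p\<^sub>j(x) \<partial>\<^sup>j\<close> of the Weyl algebra \<open>\<complex>[x, \<partial>]\<close> is represented by its normal form, the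
  \<open>complex poly poly\<close> with coefficients \<open>p\<^sub>j\<close>; \<open>diffop\<close> is its action on \<open>\<complex>[x]\<close>. The action is
  faithful, so an operator is determined by its values on polynomials.
\<close>
definition diffop :: "complex poly poly \<Rightarrow> complex poly \<Rightarrow> complex poly" where
  "diffop P y = (\<Sum>j\<le>degree P. coeff P j * (pderiv ^^ j) y)"

lemma pderiv_funpow_monom:
  "(pderiv ^^ j) (monom (1::complex) m) =
     (if j \<le> m then monom (of_nat (fact m div fact (m - j))) (m - j) else 0)"
proof (induction j)
  case (Suc j)
  have "(m - j) * (fact m div fact (m - j)) = (fact m div fact (m - Suc j) :: nat)" if "Suc j \<le> m"
  proof -
    obtain k where k: "m - j = Suc k" "m - Suc j = k"
      using \<open>Suc j \<le> m\<close> by (metis Suc_diff_Suc Suc_le_eq)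
    have "fact (Suc k) dvd (fact m :: nat)"
      using k(1) by (metis diff_le_self fact_dvd)
    then obtain c :: nat where "fact m = fact (Suc k) * c" ..
    then have c: "fact m = fact k * (Suc k * c)"
      by (simp add: algebra_simps)
    have "fact m div fact (Suc k) = c" "fact m div fact k = Suc k * c"
      using \<open>fact m = fact (Suc k) * c\<close> c by (metis fact_nonzero nonzero_mult_div_cancel_left)+
    with k show ?thesis by simp
  qed
  with Suc show ?case
    by (auto simp: pderiv_monom simp flip: of_nat_mult simp del: of_nat_diff)
qed simp

lemma diffop_inject:
  assumes "diffop P = diffop Q"
  shows "P = Q"
proof -
  define M where "M = max (degree P) (degree Q)"
  have ext: "diffop R y = (\<Sum>j\<le>M. coeff R j * (pderiv ^^ j) y)" if "degree R \<le> M" for R y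
    unfolding diffop_def using that by (intro sum.mono_neutral_left) (auto simp: coeff_eq_0)
  have "coeff P m = coeff Q m" for m
  proof (induction m rule: less_induct)
    case (less m)
    show ?case
    proof (cases "m \<le> M")
      case True
      have *: "diffop R (monom 1 m) =
          (\<Sum>j<m. coeff R j * (pderiv ^^ j) (monom 1 m)) + coeff R m * monom (fact m) 0"
        if "degree R \<le> M" for R
      proof -
        have "diffop R (monom 1 m) = (\<Sum>j\<le>m. coeff R j * (pderiv ^^ j) (monom 1 m))"
          unfolding ext[OF that] using True
          by (intro sum.mono_neutral_right) (auto simp: pderiv_funpow_monom)
        then show ?thesis
          by (simp add: lessThan_Suc_atMost[symmetric] pderiv_funpow_monom)
      qed
      have "(\<Sum>j<m. coeff P j * (pderiv ^^ j) (monom 1 m)) =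
            (\<Sum>j<m. coeff Q j * (pderiv ^^ j) (monom 1 m))"
        using less by (intro sum.cong) auto
      then have "coeff P m * monom (fact m) 0 = coeff Q m * monom (fact m) 0"
        using *[of P] *[of Q] assms by (simp add: M_def)
      then show ?thesis by simp
    next
      case False
      then show ?thesis by (simp add: M_def coeff_eq_0)
    qed
  qed
  then show ?thesis by (rule poly_eqI)
qed

text \<open>
  The operator \<open>B \<circ> f \<circ> A\<close> as an element of \<open>\<complex>[x, \<partial>]\<close>: the normal form of the unique polynomial
  operator that agrees with it on \<open>\<complex>[x]\<close>, compared away from the zeros of \<open>\<eta>\<close>. Uniqueness is
  \<open>diffop_inject\<close> together with \<open>\<eta> \<noteq> 0\<close>; existence, for \<open>f\<close> in the stabilizer, is
  not built into the definition.
\<close>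
definition BfA :: "nat list \<Rightarrow> complex poly \<Rightarrow> complex poly poly" where
  "BfA lam f = (THE P. \<forall>y x. poly (eta lam) x \<noteq> 0 \<longrightarrow>
     poly (diffop P y) x = B_op lam (poly (f * A_op lam y)) x)"

text \<open>
  Difference operators act on sequences \<open>nat \<Rightarrow> complex\<close>. At \<open>n = 0\<close> the term \<open>n g(n - 1)\<close>
  vanishes because of the factor \<open>n\<close>.
\<close>
definition Delta_op :: "(nat \<Rightarrow> complex) \<Rightarrow> nat \<Rightarrow> complex" where
  "Delta_op g n = g (n + 1) / 2 + of_nat n * g (n - 1)"

definition Gamma_op :: "(nat \<Rightarrow> complex) \<Rightarrow> nat \<Rightarrow> complex" where
  "Gamma_op g n = 2 * of_nat n * g (n - 1)"

text \<open>The linear map with \<open>x\<^sup>i \<partial>\<^sup>j \<mapsto> \<Gamma>\<^sup>j \<Delta>\<^sup>i\<close>.\<close>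
definition flat :: "complex poly poly \<Rightarrow> (nat \<Rightarrow> complex) \<Rightarrow> nat \<Rightarrow> complex" where
  "flat P g n = (\<Sum>j\<le>degree P. \<Sum>i\<le>degree (coeff P j).
     coeff (coeff P j) i * (Gamma_op ^^ j) ((Delta_op ^^ i) g) n)"

definition pi_fun :: "nat list \<Rightarrow> nat \<Rightarrow> complex" where
  "pi_fun lam n = (\<Prod>k\<leftarrow>kseq lam. - 2 * of_nat n + 2 * of_nat k)"

text \<open>
  With \<open>d = N - l\<close>, a function of \<open>n \<ge> d\<close> is a sequence whose values below \<open>d\<close> are irrelevant:
  \<open>shift_fwd d\<close> (that is, \<open>\<Theta>\<^sup>d\<close>) does not read them, and \<open>shift_back d\<close> (its inverse) is
  meaningful at \<open>n \<ge> d\<close>.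
\<close>
definition shift_fwd :: "nat \<Rightarrow> (nat \<Rightarrow> complex) \<Rightarrow> nat \<Rightarrow> complex" where
  "shift_fwd d g n = g (n + d)"

definition shift_back :: "nat \<Rightarrow> (nat \<Rightarrow> complex) \<Rightarrow> nat \<Rightarrow> complex" where
  "shift_back d g n = g (n - d)"

text \<open>
  As \<open>1 / 0 = 0\<close>, the factor \<open>1 / pi_fun lam m\<close> makes the sequence zero at the \<open>m\<close> in
  \<open>set (kseq lam)\<close>, the zeros of \<open>pi_fun lam\<close>; this is the intended convention there.
\<close>
definition Delta_hat :: "nat list \<Rightarrow> complex poly \<Rightarrow> (nat \<Rightarrow> complex) \<Rightarrow> nat \<Rightarrow> complex" where
  "Delta_hat lam f =
     (let d = sum_list lam - length lam in
      shift_back d \<circ> flat (BfA lam f) \<circ> (\<lambda>g m. 1 / pi_fun lam m * g m) \<circ> shift_fwd d)"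

end

theory Submission
  imports Defs
begin

text \<open>
  Everything rests on \<open>B \<circ> A = \<pi>(m)\<close> on \<open>h(m)\<close>. Let \<open>f\<^sub>j = h(k\<^sub>j)\<close>, let \<open>H\<^sub>j = \<plusminus> htilde\<^sub>j\<close> be the
  cofactors of the last row of the Wronskian matrix of the \<open>f\<^sub>j\<close>, and let \<open>y\<close> be an eigenfunction
  of \<open>T = \<partial>\<^sup>2 - 2x\<partial>\<close>. Then \<open>A y = \<Sum>\<^sub>j c\<^sub>j H\<^sub>j Wr(f\<^sub>j, y)\<close> with constants \<open>c\<^sub>j\<close>, and \<open>exp(-x\<^sup>2) Wr(f\<^sub>j, y)\<close>
  has derivative a multiple of \<open>exp(-x\<^sup>2) f\<^sub>j y\<close>. Because \<open>\<Sum>\<^sub>j f\<^sub>j \<partial>\<^sup>q H\<^sub>j = 0\<close> for \<open>q < l - 1\<close>, column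
  operations reduce the Wronskian of the \<open>H\<^sub>j\<close> and \<open>exp(-x\<^sup>2) A y\<close> to a single entry. The same identity gives
  \<open>\<eta> \<noteq> 0\<close> by induction on \<open>l\<close>.

  For \<open>f\<close> in the stabilizer, \<open>f A h(m) = \<Sum>\<^sub>j e\<^sub>j A h(j)\<close> with \<open>e\<^sub>j = 0\<close> for \<open>j \<in> K\<close>, so
  \<open>B f A h(m) = \<Sum>\<^sub>j e\<^sub>j \<pi>(j) h(j)\<close>. Hence \<open>B f A\<close> maps polynomials to polynomials, which forces its
  coefficients to be polynomials. As \<open>flat\<close> turns an operator in \<open>x\<close> into its matrix in the
  basis \<open>h(j)\<close>, row \<open>m\<close> of \<open>flat (B f A)\<close> is \<open>(e\<^sub>j \<pi>(j))\<^sub>j\<close>; applied to \<open>A h(j) / \<pi>(j)\<close> it gives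
  \<open>\<Sum>\<^sub>j e\<^sub>j A h(j) = f A h(m)\<close>.
\<close>

section \<open>Hermite polynomials\<close>

lemma pderiv_hermite_Suc:
  "pderiv (hermite (Suc n)) = smult (of_nat (2 * Suc n)) (hermite n)"
proof (induction n rule: hermite.induct)
  case (3 n)
  let ?b = "of_nat (2 * Suc n) :: complex" and ?c = "of_nat (2 * Suc (Suc n)) :: complex"
  have rec: "hermite (Suc (Suc n)) = [:0, 2:] * hermite (Suc n) - smult ?b (hermite n)"
    by (rule hermite.simps)
  have "hermite (Suc (Suc (Suc n))) = [:0, 2:] * hermite (Suc (Suc n)) - smult ?c (hermite (Suc n))"
    by (rule hermite.simps)
  also have "pderiv \<dots> = [:0, 2:] * smult ?c (hermite (Suc n)) + smult 2 (hermite (Suc (Suc n)))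
      - smult ?c (smult ?b (hermite n))"
    unfolding pderiv_diff pderiv_mult pderiv_smult 3 by (simp add: pderiv_pCons)
  also have "\<dots> = smult ?c ([:0, 2:] * hermite (Suc n) - smult ?b (hermite n)) + smult 2 (hermite (Suc (Suc n)))"
    by (simp only: smult_diff_right mult_smult_right diff_add_eq)
  also have "\<dots> = smult (?c + 2) (hermite (Suc (Suc n)))"
    by (simp only: rec smult_add_left)
  also have "?c + 2 = of_nat (2 * Suc (Suc (Suc n)))"
    by simp
  finally show ?case .
qed (simp_all add: pderiv_pCons one_pCons)

lemma pderiv_hermite: "pderiv (hermite n) = smult (2 * of_nat n) (hermite (n - 1))"
  by (cases n) (simp_all del: hermite.simps add: pderiv_hermite_Suc hermite.simps(1))

lemma hermite_recurrence:
  "[:0, 1:] * hermite n = smult (1 / 2) (hermite (n + 1)) + smult (of_nat n) (hermite (n - 1))"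
proof (cases n)
  case (Suc k)
  have "[:0, 2:] * hermite (Suc k) = hermite (Suc (Suc k)) + smult (2 * of_nat (Suc k)) (hermite k)"
    by simp
  then have "smult (1/2) ([:0, 2:] * hermite (Suc k)) =
      smult (1/2) (hermite (Suc (Suc k))) + smult (of_nat (Suc k)) (hermite k)"
    by (simp only: smult_add_right smult_smult) (simp del: of_nat_Suc hermite.simps)
  then show ?thesis
    using Suc by (simp del: hermite.simps of_nat_Suc)
qed simp

text \<open>Two applications of the derivative rule followed by the recurrence. Hermite polynomials
  enter the Wronskian identities only as these eigenfunctions of \<open>T\<close>.\<close>

lemma hermite_ode:
  "pderiv (pderiv (hermite n)) - [:0, 2:] * pderiv (hermite n) = smult (- 2 * of_nat n) (hermite n)"
proof (cases n rule: hermite.cases)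
  case (3 k)
  have "pderiv (pderiv (hermite n)) = smult (of_nat (2 * n)) (smult (of_nat (2 * Suc k)) (hermite k))"
    unfolding 3 by (simp only: pderiv_hermite_Suc pderiv_smult)
  moreover have "pderiv (hermite n) = smult (of_nat (2 * n)) (hermite (Suc k))"
    unfolding 3 by (simp only: pderiv_hermite_Suc)
  moreover have "smult (of_nat (2 * Suc k)) (hermite k) - [:0, 2:] * hermite (Suc k) = - hermite n"
    unfolding 3 by simp
  ultimately show ?thesis
    by (metis (no_types, lifting) minus_mult_left mult_smult_right of_nat_mult of_nat_numeral smult_diff_right smult_minus_left smult_minus_right)
qed (simp_all add: pderiv_pCons)

lemma degree_hermite [simp]: "degree (hermite n) = n"
  and hermite_nonzero [simp]: "hermite n \<noteq> 0"
proof -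
  have "degree (hermite n) = n \<and> hermite n \<noteq> 0"
  proof (induction n rule: hermite.induct)
    case (3 n)
    have "degree ([:0, 2:] * hermite (Suc n)) = Suc (Suc n)"
      using 3 by (subst degree_mult_eq) auto
    moreover have "degree (smult (of_nat (2 * Suc n)) (hermite n)) = n"
      using 3 by (simp del: of_nat_Suc of_nat_mult)
    ultimately have "degree (hermite (Suc (Suc n))) = Suc (Suc n)"
      by (subst hermite.simps, subst diff_conv_add_uminus, subst degree_add_eq_left) (simp_all del: of_nat_Suc of_nat_mult)
    then show ?case by (metis degree_0 nat.distinct(1))
  qed auto
  then show "degree (hermite n) = n" "hermite n \<noteq> 0" by auto
qed

lemma hermite_independent:
  assumes "(\<Sum>j<n. smult (c j) (hermite j)) = 0" "i < n"
  shows "c i = 0"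
  using assms
proof (induction n)
  case (Suc n)
  have "coeff (\<Sum>j<n. smult (c j) (hermite j)) n = 0"
    by (simp add: coeff_sum coeff_eq_0)
  then have "c n * coeff (hermite n) n = 0"
    using arg_cong[OF Suc.prems(1), of "\<lambda>p. coeff p n"] by simp
  then have "c n = 0"
    using degree_hermite[of n] hermite_nonzero[of n] by (metis leading_coeff_0_iff mult_eq_0_iff)
  then show ?case
    using Suc by (cases "i = n") auto
qed simp

lemma hermite_spans:
  fixes p :: "complex poly"
  assumes "degree p < n"
  shows "\<exists>c. p = (\<Sum>j<n. smult (c j) (hermite j))"
  using assms
proof (induction n arbitrary: p)
  case (Suc n)
  \<comment> \<open>Matching the coefficient at \<open>n\<close> leaves a remainder that is zero or
    has smaller degree.\<close>
  define a where "a = coeff p n / lead_coeff (hermite n)"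
  have *: "degree (p - smult a (hermite n)) \<le> n"
    using Suc.prems by (intro degree_diff_le) auto
  have "coeff (p - smult a (hermite n)) n = 0"
    using hermite_nonzero[of n] by (simp add: a_def flip: leading_coeff_0_iff)
  then have "p - smult a (hermite n) = 0 \<or> degree (p - smult a (hermite n)) < n"
    using * by (metis leading_coeff_0_iff order_le_less)
  moreover have "\<exists>c. 0 = (\<Sum>j<n. smult (c j) (hermite j))"
    by (rule exI[of _ "\<lambda>_. 0"]) simp
  ultimately obtain c where "p - smult a (hermite n) = (\<Sum>j<n. smult (c j) (hermite j))"
    using Suc.IH by metis
  then have "p = (\<Sum>j<Suc n. smult ((c(n := a)) j) (hermite j))"
    by (simp add: algebra_simps)
  then show ?case by blast
qed simp

section \<open>Determinants\<close>

text \<open>Each permutation in the Leibniz formula picks every column once, so every term carries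
  the same product of factors.\<close>

lemma det_scale_columns:
  "det (mat n n (\<lambda>(i, j). d j * a i j)) = (\<Prod>j<n. d j) * (det (mat n n (\<lambda>(i, j). a i j)) :: 'a::comm_ring_1)"
proof -
  have "(\<Prod>i = 0..<n. mat n n (\<lambda>(i, j). d j * a i j) $$ (i, p i)) =
      (\<Prod>j<n. d j) * (\<Prod>i = 0..<n. mat n n (\<lambda>(i, j). a i j) $$ (i, p i))"
    if p: "p permutes {0..<n}" for p
  proof -
    have lt: "p i < n" if "i < n" for i
      using permutes_in_image[OF p, of i] that by simp
    have "(\<Prod>i = 0..<n. d (p i)) = (\<Prod>j<n. d j)"
      using prod.permute[OF p, of d] by (simp add: comp_def atLeast0LessThan)
    moreover have "(\<Prod>i = 0..<n. mat n n (\<lambda>(i, j). d j * a i j) $$ (i, p i)) =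
        (\<Prod>i = 0..<n. d (p i) * mat n n (\<lambda>(i, j). a i j) $$ (i, p i))"
      using lt by (intro prod.cong) auto
    ultimately show ?thesis
      by (simp only: prod.distrib)
  qed
  then show ?thesis
    by (subst (1 2) det_def'[of _ n]) (auto simp: sum_distrib_left mult_ac intro!: sum.cong)
qed

text \<open>The new matrix is the old one multiplied on the left by a lower triangular matrix with
  unit diagonal.\<close>

lemma det_unitriangular_rows:
  fixes a b :: "nat \<Rightarrow> nat \<Rightarrow> 'a::idom"
  assumes "\<And>i j. i < n \<Longrightarrow> j < n \<Longrightarrow> b i j = a i j + (\<Sum>q<i. u i q * a q j)"
  shows "det (mat n n (\<lambda>(i, j). b i j)) = det (mat n n (\<lambda>(i, j). a i j))"
proof -
  define U where "U = mat n n (\<lambda>(i, j). if i = j then 1 else if j < i then u i j else 0)"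
  have U: "U \<in> carrier_mat n n" by (simp add: U_def)
  have "det U = prod_list (diag_mat U)"
    by (rule det_lower_triangular[OF _ U]) (auto simp: U_def)
  also have "diag_mat U = map (\<lambda>i. 1) [0..<n]"
    by (auto simp: diag_mat_def U_def)
  also have "prod_list \<dots> = 1"
    by (induction n) auto
  finally have "det U = 1" .
  moreover have "mat n n (\<lambda>(i, j). b i j) = U * mat n n (\<lambda>(i, j). a i j)"
  proof (rule eq_matI)
    fix i j assume "i < dim_row (U * mat n n (\<lambda>(i, j). a i j))" "j < dim_col (U * mat n n (\<lambda>(i, j). a i j))"
    then have ij: "i < n" "j < n" by (auto simp: U_def)
    have "(U * mat n n (\<lambda>(i, j). a i j)) $$ (i, j) = (\<Sum>q<n. (if i = q then 1 else if q < i then u i q else 0) * a q j)"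
      using ij by (simp add: U_def scalar_prod_def atLeast0LessThan)
    also have "\<dots> = (\<Sum>q<n. (if i = q then a q j else 0) + (if q < i then u i q * a q j else 0))"
      by (intro sum.cong) auto
    also have "\<dots> = a i j + (\<Sum>q\<in>{..<n} \<inter> {q. q < i}. u i q * a q j)"
      using ij by (simp add: sum.distrib sum.inter_restrict)
    also have "{..<n} \<inter> {q. q < i} = {..<i}" using ij by auto
    finally show "mat n n (\<lambda>(i, j). b i j) $$ (i, j) = (U * mat n n (\<lambda>(i, j). a i j)) $$ (i, j)"
      using ij assms by simp
  qed (auto simp: U_def)
  ultimately show ?thesis
    using det_mult[OF U, of "mat n n (\<lambda>(i, j). a i j)"] by simp
qed

text \<open>Only the last entry of the first row survives the expansion, and its minor again has
  zeros above the antidiagonal.\<close>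

lemma det_antitriangular:
  fixes a :: "nat \<Rightarrow> nat \<Rightarrow> 'a::comm_ring_1"
  assumes "\<And>i j. i + j + 1 < n \<Longrightarrow> a i j = 0"
  shows "det (mat n n (\<lambda>(i, j). a i j)) = (\<Prod>i<n. (- 1) ^ (n - 1 - i) * a i (n - 1 - i))"
  using assms
proof (induction n arbitrary: a)
  case (Suc n)
  let ?A = "mat (Suc n) (Suc n) (\<lambda>(i, j). a i j)"
  have "det ?A = (\<Sum>j<Suc n. ?A $$ (0, j) * cofactor ?A 0 j)"
    by (rule laplace_expansion_row) auto
  also have "\<dots> = a 0 n * cofactor ?A 0 n"
    using Suc.prems by (simp add: sum.neutral)
  also have "mat_delete ?A 0 n = mat n n (\<lambda>(i, j). a (Suc i) j)"
    by (auto simp: mat_delete_def)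
  then have "cofactor ?A 0 n = (- 1) ^ n * det (mat n n (\<lambda>(i, j). a (Suc i) j))"
    by (simp add: cofactor_def)
  also have "det (mat n n (\<lambda>(i, j). a (Suc i) j)) = (\<Prod>i<n. (- 1) ^ (n - 1 - i) * a (Suc i) (n - 1 - i))"
    using Suc.prems by (intro Suc.IH) auto
  finally show ?case
    by (simp add: prod.lessThan_Suc_shift mult_ac del: prod.lessThan_Suc)
qed simp

text \<open>The cofactors along the last column do not see that column, so this determinant is linear in \<open>v\<close>.\<close>
definition bordered :: "nat \<Rightarrow> (nat \<Rightarrow> nat \<Rightarrow> 'a) \<Rightarrow> (nat \<Rightarrow> 'a) \<Rightarrow> 'a mat" where
  "bordered n a v = mat (Suc n) (Suc n) (\<lambda>(i, j). if j < n then a i j else v i)"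

lemma det_bordered:
  fixes a :: "nat \<Rightarrow> nat \<Rightarrow> 'a::comm_ring_1"
  shows "det (bordered n a v) = (\<Sum>i\<le>n. v i * cofactor (bordered n a (\<lambda>_. 0)) i n)"
proof -
  have "mat_delete (bordered n a v) i n = mat_delete (bordered n a (\<lambda>_. 0)) i n" for i
    by (auto simp: mat_delete_def bordered_def)
  then have "cofactor (bordered n a v) i n = cofactor (bordered n a (\<lambda>_. 0)) i n" for i
    by (simp add: cofactor_def)
  then show ?thesis
    by (subst laplace_expansion_column[of _ "Suc n" n])
      (auto simp: bordered_def lessThan_Suc_atMost intro!: sum.cong)
qed

lemma det_bordered_last:
  "det (bordered n a (\<lambda>i. if i = n then t else 0)) = t * (det (mat n n (\<lambda>(i, j). a i j)) :: 'a::comm_ring_1)"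
proof -
  have "det (bordered n a (\<lambda>i. if i = n then t else 0)) =
      (\<Sum>i\<le>n. if i = n then t * cofactor (bordered n a (\<lambda>_. 0)) n n else 0)"
    by (subst det_bordered) (rule sum.cong, auto)
  moreover have "mat_delete (bordered n a (\<lambda>_. 0)) n n = mat n n (\<lambda>(i, j). a i j)"
    by (auto simp: mat_delete_def bordered_def)
  ultimately show ?thesis by (simp add: cofactor_def)
qed

lemma det_bordered_column:
  assumes "j < n"
  shows "det (bordered n a (\<lambda>i. a i j)) = (0 :: 'a::comm_ring_1)"
  by (rule det_identical_columns[of _ "Suc n" j n]) (use assms in \<open>auto simp: bordered_def intro!: eq_vecI\<close>)

lemma det_bordered_add:
  "det (bordered n a (\<lambda>i. v i + w i)) = det (bordered n a v) + (det (bordered n a w) :: 'a::comm_ring_1)"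
  by (simp add: det_bordered[of n a "\<lambda>i. v i + w i"] det_bordered[of n a v] det_bordered[of n a w] sum.distrib algebra_simps)

lemma det_bordered_mult:
  "det (bordered n a (\<lambda>i. c * v i)) = c * (det (bordered n a v) :: 'a::comm_ring_1)"
  by (simp add: det_bordered[of n a "\<lambda>i. c * v i"] det_bordered[of n a v] sum_distrib_left algebra_simps)

lemma det_bordered_sum:
  "det (bordered n a (\<lambda>i. \<Sum>j\<in>S. v j i)) = (\<Sum>j\<in>S. det (bordered n a (v j)) :: 'a::comm_ring_1)"
  by (simp add: det_bordered[of n a "\<lambda>i. \<Sum>j\<in>S. v j i"] det_bordered[of n a "v _"] sum_distrib_right sum.swap[of _ S])

section \<open>Wronskians of eigenfunctions\<close>

definition wr :: "nat \<Rightarrow> (nat \<Rightarrow> complex poly) \<Rightarrow> complex poly" where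
  "wr n f = det (mat n n (\<lambda>(i, j). (pderiv ^^ i) (f j)))"

definition wr_cofactor :: "nat \<Rightarrow> (nat \<Rightarrow> complex poly) \<Rightarrow> nat \<Rightarrow> complex poly" where
  "wr_cofactor n f j = cofactor (mat n n (\<lambda>(i, j). (pderiv ^^ i) (f j))) (n - 1) j"

text \<open>Identifies the cofactors, up to sign, with the Wronskians that omit one function:
  \<open>insert_index j\<close> skips \<open>j\<close>.\<close>

lemma wr_cofactor_Suc:
  assumes "j \<le> m"
  shows "wr_cofactor (Suc m) f j = (- 1) ^ (m + j) * wr m (\<lambda>i. f (insert_index j i))"
proof -
  have "mat_delete (mat (Suc m) (Suc m) (\<lambda>(i, j). (pderiv ^^ i) (f j))) m j =
      mat m m (\<lambda>(i, k). (pderiv ^^ i) (f (insert_index j k)))"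
    using assms by (auto simp: mat_delete_def insert_index_def)
  then show ?thesis
    by (simp add: wr_cofactor_def wr_def cofactor_def)
qed

lemma pderiv_sum: "pderiv (\<Sum>j\<in>S. p j) = (\<Sum>j\<in>S. pderiv (p j))"
  using higher_pderiv_sum[of 1 p S] by simp

text \<open>This is the last column of the matrix times its adjugate.\<close>

lemma sum_wr_cofactor:
  assumes "p < n"
  shows "(\<Sum>j<n. (pderiv ^^ p) (f j) * wr_cofactor n f j) = (if p = n - 1 then wr n f else 0)"
proof -
  let ?A = "mat n n (\<lambda>(i, j). (pderiv ^^ i) (f j))"
  have "(?A * adj_mat ?A) $$ (p, n - 1) = (det ?A \<cdot>\<^sub>m 1\<^sub>m n) $$ (p, n - 1)"
    by (subst adj_mat(2)) auto
  moreover have "(?A * adj_mat ?A) $$ (p, n - 1) = (\<Sum>j<n. (pderiv ^^ p) (f j) * wr_cofactor n f j)"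
    using assms by (simp add: adj_mat_def scalar_prod_def wr_cofactor_def atLeast0LessThan)
  ultimately show ?thesis
    using assms by (cases "p = n - 1") (auto simp: wr_def)
qed

text \<open>Below total order \<open>n - 1\<close> the sum is zero, and so is its derivative; by the
  product rule a derivative moves from \<open>f j\<close> to the cofactor at the cost of a
  sign.\<close>

lemma sum_wr_cofactor_deriv:
  assumes "p + q \<le> n - 1" "0 < n"
  shows "(\<Sum>j<n. (pderiv ^^ p) (f j) * (pderiv ^^ q) (wr_cofactor n f j)) =
    (if p + q = n - 1 then (- 1) ^ q * wr n f else 0)"
  using assms(1)
proof (induction q arbitrary: p)
  case 0
  then show ?case
    using sum_wr_cofactor[of p n f] assms(2) by auto
next
  case (Suc q)
  have "(\<Sum>j<n. (pderiv ^^ Suc p) (f j) * (pderiv ^^ q) (wr_cofactor n f j)) +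
      (\<Sum>j<n. (pderiv ^^ p) (f j) * (pderiv ^^ Suc q) (wr_cofactor n f j)) =
      pderiv (\<Sum>j<n. (pderiv ^^ p) (f j) * (pderiv ^^ q) (wr_cofactor n f j))"
    by (simp add: pderiv_sum pderiv_mult sum.distrib algebra_simps)
  also have "\<dots> = 0"
    using Suc by simp
  finally have "(\<Sum>j<n. (pderiv ^^ p) (f j) * (pderiv ^^ Suc q) (wr_cofactor n f j)) =
      - (\<Sum>j<n. (pderiv ^^ Suc p) (f j) * (pderiv ^^ q) (wr_cofactor n f j))"
    by (simp add: add_eq_0_iff)
  then show ?case
    using Suc.IH[of "Suc p"] Suc.prems by simp
qed

text \<open>The Wronskian matrix of the cofactors times the transposed one of \<open>f\<close> is
  antitriangular by \<open>sum_wr_cofactor_deriv\<close>. Keeping \<open>wr n f\<close> on the left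
  avoids a division.\<close>

lemma wr_wr_cofactor:
  assumes "0 < n"
  shows "wr n (wr_cofactor n f) * wr n f = wr n f ^ n"
proof -
  let ?P = "mat n n (\<lambda>(i, j). (pderiv ^^ i) (wr_cofactor n f j))"
  let ?A = "mat n n (\<lambda>(i, j). (pderiv ^^ i) (f j))"
  let ?r = "\<lambda>q p. \<Sum>j<n. (pderiv ^^ p) (f j) * (pderiv ^^ q) (wr_cofactor n f j)"
  have "wr n (wr_cofactor n f) * wr n f = det ?P * det (transpose_mat ?A)"
    by (simp add: wr_def det_transpose[of ?A n])
  also have "\<dots> = det (?P * transpose_mat ?A)"
    by (rule det_mult[symmetric]) auto
  also have "?P * transpose_mat ?A = mat n n (\<lambda>(q, p). ?r q p)"
    by (rule eq_matI) (auto simp: scalar_prod_def atLeast0LessThan mult.commute)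
  also have "det \<dots> = (\<Prod>i<n. (- 1) ^ (n - 1 - i) * ?r i (n - 1 - i))"
    by (rule det_antitriangular, subst sum_wr_cofactor_deriv) (use assms in auto)
  also have "\<dots> = (\<Prod>i<n. (- 1) ^ (n - 1) * wr n f)"
  proof (rule prod.cong)
    fix i assume "i \<in> {..<n}"
    then have i: "(n - 1 - i) + i = n - 1" by auto
    then have "?r i (n - 1 - i) = (- 1) ^ i * wr n f"
      using assms by (subst sum_wr_cofactor_deriv) auto
    then show "(- 1) ^ (n - 1 - i) * ?r i (n - 1 - i) = (- 1) ^ (n - 1) * wr n f"
      using i by (metis mult.assoc power_add)
  qed simp
  also have "\<dots> = wr n f ^ n"
  proof -
    have "even ((n - 1) * n)" by (cases n) auto
    then show ?thesis
      by (simp add: power_mult_distrib flip: power_mult)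
  qed
  finally show ?thesis .
qed

text \<open>\<open>nabla = exp(x\<^sup>2) \<circ> \<partial> \<circ> exp(-x\<^sup>2)\<close>\<close>
definition nabla :: "complex poly \<Rightarrow> complex poly" where
  "nabla p = pderiv p - [:0, 2:] * p"

section \<open>Calculus of \<open>nabla\<close> and the dual Wronskian identity\<close>

lemma nabla_add: "nabla (p + q) = nabla p + nabla q"
  by (simp add: nabla_def pderiv_add algebra_simps)

lemma nabla_0 [simp]: "nabla 0 = 0"
  by (simp add: nabla_def)

lemma nabla_smult: "nabla (smult c p) = smult c (nabla p)"
  by (simp add: nabla_def pderiv_smult smult_diff_right)

lemma nabla_sum: "nabla (\<Sum>j\<in>S. p j) = (\<Sum>j\<in>S. nabla (p j))"
  by (induction S rule: infinite_finite_induct) (simp_all add: nabla_add)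

lemma nabla_mult: "nabla (p * q) = pderiv p * q + p * nabla q"
  by (simp add: nabla_def pderiv_mult algebra_simps)

text \<open>The lower-order coefficients \<open>u\<close> are the same for all \<open>g\<close>,
  which is what makes the passage to these operators a row operation.\<close>

lemma funpow_pderiv_monic:
  "\<exists>u. \<forall>g. (pderiv ^^ i) (pderiv (pderiv g) - [:0, 2:] * pderiv g - smult \<mu> g) =
     (pderiv ^^ (i + 2)) g + (\<Sum>q<i+2. u q * (pderiv ^^ q) g :: complex poly)"
proof (induction i)
  case 0
  show ?case
    by (rule exI[of _ "\<lambda>q. if q = 0 then [:- \<mu>:] else - [:0, 2:]"])
      (simp add: numeral_2_eq_2 lessThan_Suc algebra_simps)
next
  case (Suc i)
  then obtain u where u: "\<And>g. (pderiv ^^ i) (pderiv (pderiv g) - [:0, 2:] * pderiv g - smult \<mu> g) =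
     (pderiv ^^ (i + 2)) g + (\<Sum>q<i+2. u q * (pderiv ^^ q) g)"
    by auto
  \<comment> \<open>Product rule: one part from differentiating the coefficient, one from raising
    the order.\<close>
  define v where "v q = (if q < i + 2 then pderiv (u q) else 0) + (if q = 0 then 0 else u (q - 1))" for q
  have "(pderiv ^^ Suc i) (pderiv (pderiv g) - [:0, 2:] * pderiv g - smult \<mu> g) =
     (pderiv ^^ (Suc i + 2)) g + (\<Sum>q<Suc i + 2. v q * (pderiv ^^ q) g)" for g
  proof -
    have "(\<Sum>q<Suc i + 2. (if q < i + 2 then pderiv (u q) else 0) * (pderiv ^^ q) g) =
        (\<Sum>q<i+2. pderiv (u q) * (pderiv ^^ q) g)"
      by simp
    moreover have "(\<Sum>q<Suc (i + 2). (if q = 0 then 0 else u (q - 1)) * (pderiv ^^ q) g) =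
        (\<Sum>q<i+2. u q * (pderiv ^^ Suc q) g)"
      by (subst sum.lessThan_Suc_shift) simp
    ultimately have "(\<Sum>q<Suc i + 2. v q * (pderiv ^^ q) g) =
        (\<Sum>q<i+2. pderiv (u q) * (pderiv ^^ q) g) + (\<Sum>q<i+2. u q * (pderiv ^^ Suc q) g)"
      unfolding v_def distrib_right sum.distrib by simp
    moreover have "(pderiv ^^ Suc i) (pderiv (pderiv g) - [:0, 2:] * pderiv g - smult \<mu> g) =
        pderiv ((pderiv ^^ (i + 2)) g + (\<Sum>q<i+2. u q * (pderiv ^^ q) g))"
      using u[of g] by simp
    ultimately show ?thesis
      by (simp add: pderiv_add pderiv_sum pderiv_mult sum.distrib algebra_simps)
  qed
  then show ?case by blast
qed

lemma prod_pCons_0: "(\<Prod>i\<in>S. [:c i:]) = [:\<Prod>i\<in>S. c i :: complex:]"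
  by (induction S rule: infinite_finite_induct) (auto simp: one_pCons)

text \<open>
  Replacing the rows \<open>\<partial>\<^sup>i\<^sup>+\<^sup>2\<close> of the Wronskian by \<open>\<partial>\<^sup>i \<circ> (T - \<mu>)\<close>, \<open>T = \<partial>\<^sup>2 - 2x\<partial>\<close>, is a unitriangular
  row operation which clears the column of \<open>y\<close> below its first two entries.
\<close>
lemma wronskian_eigen_expand:
  assumes f: "\<And>j. j < n \<Longrightarrow> pderiv (pderiv (f j)) - [:0, 2:] * pderiv (f j) = smult (\<kappa> j) (f j)"
    and y: "pderiv (pderiv y) - [:0, 2:] * pderiv y = smult \<mu> y"
    and n: "0 < n"
  shows "det (bordered n (\<lambda>i j. (pderiv ^^ i) (f j)) (\<lambda>i. (pderiv ^^ i) y)) =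
    (\<Sum>j<n. wr_cofactor n f j * smult (\<Prod>i\<in>{..<n} - {j}. \<kappa> i - \<mu>) (f j * pderiv y - pderiv (f j) * y))"
proof -
  obtain m where m: "n = Suc m" using n by (cases n) auto
  \<comment> \<open>\<open>T - \<mu>\<close> has order two, so rows 0 and 1 stay; from row 2 on the
    entry of \<open>y\<close> is zero.\<close>
  define R where "R i g = (if i = 0 then g else if i = 1 then pderiv g else
     (pderiv ^^ (i - 2)) (pderiv (pderiv g) - [:0, 2:] * pderiv g - smult \<mu> g))" for i g
  define F where "F j = (if j < n then f j else y)" for j
  have "\<exists>u. \<forall>g. R i g = (pderiv ^^ i) g + (\<Sum>q<i. u q * (pderiv ^^ q) g)" for i
  proof -
    consider "i = 0" | "i = 1" | k where "i = k + 2"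
      by (metis One_nat_def Suc_1 add_Suc_right add_0_right not0_implies_Suc)
    then show ?thesis
    proof cases
      case 3
      then show ?thesis
        using funpow_pderiv_monic[of k \<mu>] by (simp add: R_def)
    qed (auto simp: R_def intro!: exI[of _ "\<lambda>_. 0"])
  qed
  then obtain u where u: "\<And>i g. R i g = (pderiv ^^ i) g + (\<Sum>q<i. u i q * (pderiv ^^ q) g)"
    by metis
  let ?M = "mat (Suc n) (Suc n) (\<lambda>(i, j). R i (F j))"
  have "bordered n (\<lambda>i j. (pderiv ^^ i) (f j)) (\<lambda>i. (pderiv ^^ i) y) =
      mat (Suc n) (Suc n) (\<lambda>(i, j). (pderiv ^^ i) (F j))"
    by (auto simp: bordered_def F_def)
  then have "det (bordered n (\<lambda>i j. (pderiv ^^ i) (f j)) (\<lambda>i. (pderiv ^^ i) y)) = det ?M"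
    using det_unitriangular_rows[of "Suc n" "\<lambda>i j. R i (F j)" "\<lambda>i j. (pderiv ^^ i) (F j)" u] u
    by simp
  also have "\<dots> = (\<Sum>i<Suc n. ?M $$ (i, n) * cofactor ?M i n)"
    by (rule laplace_expansion_column) auto
  also have "\<dots> = (\<Sum>i\<in>{0, 1}. ?M $$ (i, n) * cofactor ?M i n)"
  proof (rule sum.mono_neutral_right)
    show "\<forall>i\<in>{..<Suc n} - {0, 1}. ?M $$ (i, n) * cofactor ?M i n = 0"
      using y by (auto simp: R_def F_def)
  qed (use n in auto)
  also have "\<dots> = y * cofactor ?M 0 n + pderiv y * cofactor ?M 1 n"
    using n by (simp add: R_def F_def)
  finally have det_eq: "det (bordered n (\<lambda>i j. (pderiv ^^ i) (f j)) (\<lambda>i. (pderiv ^^ i) y)) =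
    y * cofactor ?M 0 n + pderiv y * cofactor ?M 1 n" .
  \<comment> \<open>Both surviving minors have this shape, with \<open>g\<close> taken from
    whichever of rows 0 and 1 is not deleted.\<close>
  define N where "N g = mat n n (\<lambda>(i, j). if i = 0 then g j
      else smult (\<kappa> j - \<mu>) ((pderiv ^^ (i - 1)) (f j)))" for g
  have R_f: "R (Suc (Suc i)) (f j) = smult (\<kappa> j - \<mu>) ((pderiv ^^ i) (f j))" if "j < n" for i j
    using f[OF that] by (simp add: R_def higher_pderiv_smult flip: smult_diff_left)
  have "mat_delete ?M 0 n = N (\<lambda>j. pderiv (f j))"
  proof (rule eq_matI)
    fix i j assume "i < dim_row (N (\<lambda>j. pderiv (f j)))" "j < dim_col (N (\<lambda>j. pderiv (f j)))"
    then show "mat_delete ?M 0 n $$ (i, j) = N (\<lambda>j. pderiv (f j)) $$ (i, j)"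
      by (cases i) (simp_all add: mat_delete_def N_def F_def R_f, simp add: R_def)
  qed (auto simp: mat_delete_def N_def)
  moreover have "mat_delete ?M 1 n = N f"
  proof (rule eq_matI)
    fix i j assume "i < dim_row (N f)" "j < dim_col (N f)"
    then show "mat_delete ?M 1 n $$ (i, j) = N f $$ (i, j)"
      by (cases i) (simp_all add: mat_delete_def N_def F_def R_f, simp add: R_def)
  qed (auto simp: mat_delete_def N_def)
  ultimately have cof: "cofactor ?M 0 n = (- 1) ^ n * det (N (\<lambda>j. pderiv (f j)))"
      "cofactor ?M 1 n = (- 1) ^ (n + 1) * det (N f)"
    by (simp_all add: cofactor_def)
  have det_N: "det (N g) = (\<Sum>j<n. g j * ((- 1) ^ m * smult (\<Prod>i\<in>{..<n} - {j}. \<kappa> i - \<mu>) (wr_cofactor n f j)))" for g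
  proof -
    have "det (N g) = (\<Sum>j<n. N g $$ (0, j) * cofactor (N g) 0 j)"
      using n by (intro laplace_expansion_row) (auto simp: N_def)
    also have "\<dots> = (\<Sum>j<n. g j * ((- 1) ^ m * smult (\<Prod>i\<in>{..<n} - {j}. \<kappa> i - \<mu>) (wr_cofactor n f j)))"
    proof (rule sum.cong)
      fix j assume "j \<in> {..<n}"
      then have j: "j < n" "j \<le> m" by (auto simp: m)
      \<comment> \<open>The factors \<open>\<kappa> - \<mu>\<close> are constant along columns;
        taken out, they leave the Wronskian without \<open>f j\<close>.\<close>
      have "mat_delete (N g) 0 j = mat m m (\<lambda>(i, k). [:\<kappa> (insert_index j k) - \<mu>:] * (pderiv ^^ i) (f (insert_index j k)))"
        using j by (auto simp: mat_delete_def N_def m insert_index_def)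
      then have "det (mat_delete (N g) 0 j) = (\<Prod>k<m. [:\<kappa> (insert_index j k) - \<mu>:]) * wr m (\<lambda>k. f (insert_index j k))"
        by (simp only: det_scale_columns wr_def)
      moreover have "(\<Prod>k<m. \<kappa> (insert_index j k) - \<mu>) = (\<Prod>i\<in>{..<n} - {j}. \<kappa> i - \<mu>)"
      proof -
        have "{..<n} - {j} = insert_index j ` {..<m}"
          using insert_index_image[of j m] j by (simp add: m atLeast0LessThan)
        then show ?thesis
          by (simp add: prod.reindex insert_index_inj_on)
      qed
      ultimately have "det (mat_delete (N g) 0 j) =
          smult (\<Prod>i\<in>{..<n} - {j}. \<kappa> i - \<mu>) (wr m (\<lambda>k. f (insert_index j k)))"
        by (simp add: prod_pCons_0)
      then have "cofactor (N g) 0 j = (- 1) ^ m * smult (\<Prod>i\<in>{..<n} - {j}. \<kappa> i - \<mu>) (wr_cofactor n f j)"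
        using j by (simp add: cofactor_def m wr_cofactor_Suc power_add mult.assoc flip: power_mult_distrib)
      then show "N g $$ (0, j) * cofactor (N g) 0 j =
          g j * ((- 1) ^ m * smult (\<Prod>i\<in>{..<n} - {j}. \<kappa> i - \<mu>) (wr_cofactor n f j))"
        using j n by (simp add: N_def)
    qed simp
    finally show ?thesis .
  qed
  define s :: "complex poly" where "s = (- 1) ^ m"
  have s: "s * s = 1"
    by (simp add: s_def flip: power_mult_distrib)
  have sgn: "(- 1) ^ n = - s" "(- 1) ^ (n + 1) = s" "(- 1) ^ m = s"
    by (simp_all add: s_def m)
  have "y * (- s * (pderiv (f j) * (s * smult c w))) + pderiv y * (s * (f j * (s * smult c w))) =
      w * smult c (f j * pderiv y - pderiv (f j) * y)" for j c w
  proof -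
    have "y * (- s * (pderiv (f j) * (s * smult c w))) + pderiv y * (s * (f j * (s * smult c w))) =
        (s * s) * smult c w * (f j * pderiv y - pderiv (f j) * y)"
      by (simp add: algebra_simps del: mult_smult_right mult_smult_left)
    then show ?thesis
      by (simp add: s)
  qed
  then show ?thesis
    unfolding det_eq cof det_N sgn
    by (simp only: sum_distrib_left flip: sum.distrib)
qed

text \<open>The identity for \<open>B\<close> after \<open>A\<close> on an eigenfunction, still with
  signed cofactors and without the denominator of \<open>B\<close>.\<close>

lemma dual_wronskian_eigen:
  assumes f: "\<And>j. j < n \<Longrightarrow> pderiv (pderiv (f j)) - [:0, 2:] * pderiv (f j) = smult (\<kappa> j) (f j)"
    and y: "pderiv (pderiv y) - [:0, 2:] * pderiv y = smult \<mu> y"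
    and n: "0 < n"
  defines "a \<equiv> det (bordered n (\<lambda>i j. (pderiv ^^ i) (f j)) (\<lambda>i. (pderiv ^^ i) y))"
  shows "det (bordered n (\<lambda>i j. (pderiv ^^ i) (wr_cofactor n f j)) (\<lambda>i. (nabla ^^ i) a)) =
    smult (\<Prod>j<n. \<mu> - \<kappa> j) (wr n f ^ n * y)"
proof -
  define U where "U j = smult (\<Prod>i\<in>{..<n} - {j}. \<kappa> i - \<mu>) (f j * pderiv y - pderiv (f j) * y)" for j
  define H where "H = wr_cofactor n f"
  \<comment> \<open>Applying \<open>nabla\<close> to \<open>U j\<close> supplies, up to sign, the
    factor missing from its product; hence \<open>c\<close> does not depend on
    \<open>j\<close>.\<close>
  define c where "c = - (\<Prod>i<n. \<kappa> i - \<mu>)"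
  have a: "a = (\<Sum>j<n. H j * U j)"
    unfolding a_def U_def H_def by (rule wronskian_eigen_expand[where f = f and \<kappa> = \<kappa> and \<mu> = \<mu>, OF _ y n]) (rule f)
  have nabla_U: "nabla (U j) = smult c (f j * y)" if "j < n" for j
  proof -
    have "nabla (f j * pderiv y - pderiv (f j) * y) =
        f j * (pderiv (pderiv y) - [:0, 2:] * pderiv y) - (pderiv (pderiv (f j)) - [:0, 2:] * pderiv (f j)) * y"
      by (simp add: nabla_def pderiv_diff pderiv_mult algebra_simps)
    also have "\<dots> = smult (\<mu> - \<kappa> j) (f j * y)"
      using f[OF that] y by (simp add: smult_diff_left)
    finally have "nabla (U j) = smult ((\<Prod>i\<in>{..<n} - {j}. \<kappa> i - \<mu>) * (\<mu> - \<kappa> j)) (f j * y)"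
      by (simp add: U_def nabla_smult)
    moreover have "(\<Prod>i<n. \<kappa> i - \<mu>) = (\<kappa> j - \<mu>) * (\<Prod>i\<in>{..<n} - {j}. \<kappa> i - \<mu>)"
      using that by (intro prod.remove) auto
    then have "(\<Prod>i\<in>{..<n} - {j}. \<kappa> i - \<mu>) * (\<mu> - \<kappa> j) = c"
      by (simp add: c_def algebra_simps)
    ultimately show ?thesis by simp
  qed
  \<comment> \<open>This appears only at the \<open>n\<close>-th \<open>nabla\<close>, where the
    derivative of \<open>H j\<close> has order \<open>n - 1\<close> and its sum against
    \<open>f j\<close> first fails to vanish.\<close>
  define t where "t = smult (c * (- 1) ^ (n - 1)) (wr n f * y)"
  have iter: "(nabla ^^ i) a = (\<Sum>j<n. (pderiv ^^ i) (H j) * U j) + (if i = n then t else 0)" if "i \<le> n" for i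
    using that
  proof (induction i)
    case 0
    then show ?case using n by (simp add: a)
  next
    case (Suc i)
    have "(\<Sum>j<n. (pderiv ^^ i) (H j) * nabla (U j)) = [:c:] * (\<Sum>j<n. (pderiv ^^ 0) (f j) * (pderiv ^^ i) (H j)) * y"
      by (simp add: nabla_U sum_distrib_left sum_distrib_right mult_ac del: mult_pCons_left mult_pCons_right)
        (simp add: mult_ac)
    also have "\<dots> = (if Suc i = n then t else 0)"
      using Suc.prems n unfolding H_def by (subst sum_wr_cofactor_deriv) (auto simp: t_def minus_one_power_iff)
    finally have *: "(\<Sum>j<n. (pderiv ^^ i) (H j) * nabla (U j)) = (if Suc i = n then t else 0)" .
    have "(nabla ^^ Suc i) a = nabla (\<Sum>j<n. (pderiv ^^ i) (H j) * U j)"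
      using Suc by simp
    also have "\<dots> = (\<Sum>j<n. (pderiv ^^ Suc i) (H j) * U j) + (\<Sum>j<n. (pderiv ^^ i) (H j) * nabla (U j))"
      by (simp add: nabla_sum nabla_mult sum.distrib)
    finally show ?case using * by simp
  qed
  \<comment> \<open>The terms with \<open>U j\<close> are multiples of the other columns and drop
    out, leaving \<open>t\<close> alone in the corner.\<close>
  have "bordered n (\<lambda>i j. (pderiv ^^ i) (H j)) (\<lambda>i. (nabla ^^ i) a) =
      bordered n (\<lambda>i j. (pderiv ^^ i) (H j)) (\<lambda>i. (\<Sum>j<n. U j * (pderiv ^^ i) (H j)) + (if i = n then t else 0))"
    unfolding bordered_def by (rule eq_matI) (auto simp: iter mult.commute)
  then have "det (bordered n (\<lambda>i j. (pderiv ^^ i) (H j)) (\<lambda>i. (nabla ^^ i) a)) = t * wr n H"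
    by (simp add: det_bordered_add det_bordered_sum det_bordered_mult det_bordered_last
        det_bordered_column[where a = "\<lambda>i j. (pderiv ^^ i) (H j)"] wr_def)
  also have "\<dots> = smult (c * (- 1) ^ (n - 1)) (wr n H * wr n f * y)"
    by (simp add: t_def mult_ac)
  also have "c * (- 1) ^ (n - 1) = (\<Prod>j<n. \<mu> - \<kappa> j)"
  proof -
    have "(\<Prod>j<n. \<mu> - \<kappa> j) = (\<Prod>j<n. (- 1) * (\<kappa> j - \<mu>))"
      by (intro prod.cong) auto
    then show ?thesis
      using n by (simp only: prod.distrib) (cases n; simp add: c_def)
  qed
  finally show ?thesis
    unfolding H_def wr_wr_cofactor[OF n] .
qed

text \<open>The column signs multiply to \<open>(-1)\<close> to the power
  \<open>n (n - 1) / 2\<close>, which has the parity of \<open>n div 2\<close>; this explains the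
  sign in \<open>B\<close>.\<close>

lemma det_bordered_signs:
  assumes "0 < n"
  shows "det (bordered n (\<lambda>i j. (pderiv ^^ i) (wr_cofactor n f j)) v) =
    (- 1) ^ (n div 2) * det (bordered n (\<lambda>i j. (pderiv ^^ i) (wr (n - 1) (\<lambda>i. f (insert_index j i)))) v)"
proof -
  let ?h = "\<lambda>j. wr (n - 1) (\<lambda>i. f (insert_index j i))"
  define d where "d j = (if j < n then (- 1 :: complex poly) ^ (n - 1 - j) else 1)" for j
  have H: "wr_cofactor n f j = smult ((- 1) ^ (n - 1 - j)) (?h j)" if "j < n" for j
  proof -
    have "wr_cofactor n f j = (- 1) ^ (n - 1 + j) * ?h j"
      using wr_cofactor_Suc[of j "n - 1" f] that by simp
    also have "(- 1 :: complex poly) ^ (n - 1 + j) = (- 1) ^ (n - 1 - j)"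
      using that by (auto simp: minus_one_power_iff)
    finally show ?thesis
      by (simp add: minus_one_power_iff)
  qed
  have "bordered n (\<lambda>i j. (pderiv ^^ i) (wr_cofactor n f j)) v =
      mat (Suc n) (Suc n) (\<lambda>(i, j). d j * (if j < n then (pderiv ^^ i) (?h j) else v i))"
    unfolding bordered_def
    by (rule eq_matI) (auto simp: d_def H higher_pderiv_smult minus_one_power_iff)
  then have "det (bordered n (\<lambda>i j. (pderiv ^^ i) (wr_cofactor n f j)) v) =
      (\<Prod>j<Suc n. d j) * det (bordered n (\<lambda>i j. (pderiv ^^ i) (?h j)) v)"
    by (simp only: det_scale_columns bordered_def)
  also have "(\<Prod>j<Suc n. d j) = (\<Prod>j<n. (- 1) ^ (n - Suc j))"
    by (simp add: d_def)
  also have "\<dots> = (\<Prod>j<n. (- 1) ^ j)"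
    by (rule prod.nat_diff_reindex)
  also have "\<dots> = (- 1) ^ (n div 2)"
    by (induction n) (auto simp: minus_one_power_iff elim!: evenE oddE)
  finally show ?thesis .
qed

text \<open>Induction with \<open>f n\<close> in the role of \<open>y\<close>: if the larger
  Wronskian vanished, so would the left side of \<open>dual_wronskian_eigen\<close>, while distinct
  eigenvalues keep its right side nonzero.\<close>

lemma wr_nonzero:
  assumes f: "\<And>j. j < n \<Longrightarrow> pderiv (pderiv (f j)) - [:0, 2:] * pderiv (f j) = smult (\<kappa> j) (f j)"
    and "\<And>j. j < n \<Longrightarrow> f j \<noteq> 0" "inj_on \<kappa> {..<n}"
  shows "wr n f \<noteq> 0"
  using assms
proof (induction n)
  case 0
  then show ?case by (simp add: wr_def)
next
  case (Suc n)
  show ?case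
  \<comment> \<open>\<open>dual_wronskian_eigen\<close> requires at least one function besides
    \<open>y\<close>.\<close>
  proof (cases "n = 0")
    case True
    then show ?thesis
      using Suc.prems(2) by (simp add: wr_def det_single)
  next
    case False
    let ?a = "det (bordered n (\<lambda>i j. (pderiv ^^ i) (f j)) (\<lambda>i. (pderiv ^^ i) (f n)))"
    have "wr n f \<noteq> 0"
      using Suc.prems by (intro Suc.IH) (auto intro: inj_on_subset)
    moreover have "\<kappa> n \<noteq> \<kappa> j" if "j < n" for j
      using inj_on_contraD[OF Suc.prems(3), of n j] that by simp
    then have "(\<Prod>j<n. \<kappa> n - \<kappa> j) \<noteq> 0"
      by simp
    ultimately have "smult (\<Prod>j<n. \<kappa> n - \<kappa> j) (wr n f ^ n * f n) \<noteq> 0"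
      using Suc.prems(2) by simp
    then have "det (bordered n (\<lambda>i j. (pderiv ^^ i) (wr_cofactor n f j)) (\<lambda>i. (nabla ^^ i) ?a)) \<noteq> 0"
      using False Suc.prems(1) by (subst dual_wronskian_eigen[where \<kappa> = \<kappa> and \<mu> = "\<kappa> n"]) auto
    moreover have "(nabla ^^ i) 0 = 0" for i
      by (induction i) simp_all
    ultimately have "?a \<noteq> 0"
      \<comment> \<open>Scaling by 0 shows that a zero last column gives determinant zero.\<close>
      using det_bordered_mult[of n "\<lambda>i j. (pderiv ^^ i) (wr_cofactor n f j)" 0 "\<lambda>_. 0"] by auto
    moreover have "bordered n (\<lambda>i j. (pderiv ^^ i) (f j)) (\<lambda>i. (pderiv ^^ i) (f n)) =
        mat (Suc n) (Suc n) (\<lambda>(i, j). (pderiv ^^ i) (f j))"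
      by (auto simp: bordered_def less_Suc_eq)
    ultimately show ?thesis by (simp add: wr_def)
  qed
qed

section \<open>The operators \<open>A\<close> and \<open>B\<close>\<close>

lemma wronskian_map_pderiv: "wronskian pderiv (map f [0..<n]) = wr n f"
  unfolding wronskian_def wr_def
  by (rule arg_cong[of _ _ det]) (rule eq_matI; simp)

lemma length_kseq [simp]: "length (kseq lam) = length lam"
  by (simp add: kseq_def)

lemma map_hermite_kseq:
  "map hermite (kseq lam) = map (\<lambda>j. hermite (kseq lam ! j)) [0..<length lam]"
  by (rule nth_equalityI) simp_all

lemma eta_eq_wr: "eta lam = wr (length lam) (\<lambda>j. hermite (kseq lam ! j))"
  unfolding eta_def map_hermite_kseq wronskian_map_pderiv ..

lemma A_op_eq:
  "A_op lam y = det (bordered (length lam) (\<lambda>i j. (pderiv ^^ i) (hermite (kseq lam ! j))) (\<lambda>i. (pderiv ^^ i) y))"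
  unfolding A_op_def wronskian_def bordered_def
  by (rule arg_cong[of _ _ det]) (rule eq_matI; simp add: nth_append)

lemma htilde_eq_wr:
  assumes "j < length lam"
  shows "htilde lam j = wr (length lam - 1) (\<lambda>i. hermite (kseq lam ! insert_index j i))"
proof -
  have "map hermite (take j (kseq lam) @ drop (Suc j) (kseq lam)) =
      map (\<lambda>i. hermite (kseq lam ! insert_index j i)) [0..<length lam - 1]"
    using assms by (intro nth_equalityI) (auto simp: nth_append insert_index_def)
  then show ?thesis
    unfolding htilde_def by (simp only: wronskian_map_pderiv)
qed

text \<open>\<open>B_num = \<eta>\<^sup>l B\<close> clears the denominator of \<open>B\<close>.\<close>
definition B_num :: "nat list \<Rightarrow> complex poly \<Rightarrow> complex poly" where
  "B_num lam z = (- 1) ^ (length lam div 2) *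
     det (bordered (length lam) (\<lambda>i j. (pderiv ^^ i) (htilde lam j)) (\<lambda>i. (nabla ^^ i) z))"

section \<open>Evaluation of \<open>B\<close> on polynomials and the product of \<open>B\<close> and
  \<open>A\<close>\<close>

lemma funpow_deriv_poly: "(deriv ^^ i) (poly p) = poly ((pderiv ^^ i) p)" for p :: "complex poly"
proof (induction i)
  case (Suc i)
  have "deriv (poly q) = poly (pderiv q)" for q :: "complex poly"
    by (rule ext) (rule DERIV_imp_deriv[OF poly_DERIV])
  then show ?case using Suc by simp
qed simp

lemma funpow_deriv_gaussian_poly:
  "(deriv ^^ i) (\<lambda>z. exp (- (z\<^sup>2)) * poly p z) = (\<lambda>z. exp (- (z\<^sup>2)) * poly ((nabla ^^ i) p) z)"
proof (induction i)
  case (Suc i)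
  have "deriv (\<lambda>z. exp (- (z\<^sup>2)) * poly q z) = (\<lambda>z. exp (- (z\<^sup>2)) * poly (nabla q) z)" for q
    by (rule ext) (rule DERIV_imp_deriv,
      auto intro!: derivative_eq_intros simp: nabla_def algebra_simps)
  then show ?case using Suc by simp
qed simp

lemma B_op_poly:
  "B_op lam (poly y) x = poly (B_num lam y) x / poly (eta lam) x ^ length lam"
proof -
  let ?l = "length lam"
  let ?gs = "map (\<lambda>j. poly (htilde lam j)) [0..<?l] @ [\<lambda>z. exp (- (z\<^sup>2)) * poly y z]"
  let ?G = "mat (Suc ?l) (Suc ?l) (\<lambda>(i, j). (deriv ^^ i) (?gs ! j))"
  let ?M = "bordered ?l (\<lambda>i j. (pderiv ^^ i) (htilde lam j)) (\<lambda>i. (nabla ^^ i) y)"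
  \<comment> \<open>Evaluation at \<open>x\<close> is a ring homomorphism on functions and on
    polynomials, so both determinants can be compared entry by entry at \<open>x\<close>.\<close>
  interpret fun_ev: comm_ring_hom "\<lambda>g :: complex \<Rightarrow> complex. g x"
    by unfold_locales auto
  interpret poly_ev: comm_ring_hom "\<lambda>p :: complex poly. poly p x"
    by unfold_locales auto
  \<comment> \<open>The Gaussian occurs in the last column only; its value at \<open>x\<close>
    cancels the prefactor of \<open>B\<close>.\<close>
  define d where "d j = (if j < ?l then 1 else exp (- (x\<^sup>2)))" for j
  have "wronskian deriv ?gs x = det (map_mat (\<lambda>g. g x) ?G)"
    by (simp add: fun_ev.hom_det wronskian_def)
  also have "map_mat (\<lambda>g. g x) ?G = mat (Suc ?l) (Suc ?l) (\<lambda>(i, j). d j * poly (?M $$ (i, j)) x)"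
    by (rule eq_matI)
      (auto simp: nth_append d_def bordered_def funpow_deriv_poly funpow_deriv_gaussian_poly)
  also have "det \<dots> = exp (- (x\<^sup>2)) * det (mat (Suc ?l) (Suc ?l) (\<lambda>(i, j). poly (?M $$ (i, j)) x))"
    by (simp add: det_scale_columns d_def)
  also have "mat (Suc ?l) (Suc ?l) (\<lambda>(i, j). poly (?M $$ (i, j)) x) = map_mat (\<lambda>p. poly p x) ?M"
    by (rule eq_matI) (auto simp: bordered_def)
  finally have "wronskian deriv ?gs x = exp (- (x\<^sup>2)) * poly (det ?M) x"
    by (simp only: poly_ev.hom_det)
  moreover have "exp (x\<^sup>2) * exp (- (x\<^sup>2)) = 1"
    by (simp flip: exp_add)
  ultimately show ?thesis
    unfolding B_op_def B_num_def by (simp add: field_simps)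
qed

lemma nabla_funpow_add: "(nabla ^^ i) (p + q) = (nabla ^^ i) p + (nabla ^^ i) q"
  by (induction i) (simp_all add: nabla_add)

lemma nabla_funpow_smult: "(nabla ^^ i) (smult c p) = smult c ((nabla ^^ i) p)"
  by (induction i) (simp_all add: nabla_smult)

lemma B_num_add: "B_num lam (p + q) = B_num lam p + B_num lam q"
  by (simp add: B_num_def nabla_funpow_add det_bordered_add distrib_left)

lemma B_num_smult: "B_num lam (smult c p) = smult c (B_num lam p)"
  using det_bordered_mult[where c = "[:c:]"]
  by (simp add: B_num_def nabla_funpow_smult)

lemma B_num_sum: "B_num lam (\<Sum>j\<in>S. p j) = (\<Sum>j\<in>S. B_num lam (p j))"
proof (induction S rule: infinite_finite_induct)
  have "B_num lam 0 = 0"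
    using B_num_smult[of lam 0 0] by simp
  case (infinite S)
  then show ?case using \<open>B_num lam 0 = 0\<close> by simp
next
  case empty
  show ?case using B_num_smult[of lam 0 0] by simp
next
  case (insert j S)
  then show ?case by (simp add: B_num_add)
qed

lemma A_op_add: "A_op lam (p + q) = A_op lam p + A_op lam q"
  by (simp add: A_op_eq higher_pderiv_add det_bordered_add)

lemma A_op_smult: "A_op lam (smult c p) = smult c (A_op lam p)"
  using det_bordered_mult[where c = "[:c:]"] by (simp add: A_op_eq higher_pderiv_smult)

lemma A_op_sum: "A_op lam (\<Sum>j\<in>S. p j) = (\<Sum>j\<in>S. A_op lam (p j))"
proof (induction S rule: infinite_finite_induct)
  case (insert j S)
  then show ?case by (simp add: A_op_add)
qed (use A_op_smult[of lam 0 0] in simp_all)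

lemma pi_fun_eq: "pi_fun lam m = (\<Prod>j<length lam. - 2 * of_nat m - - 2 * of_nat (kseq lam ! j))"
  unfolding pi_fun_def by (simp add: prod.list_conv_set_nth atLeast0LessThan)

lemma pi_fun_eq_0_iff: "pi_fun lam m = 0 \<longleftrightarrow> m \<in> set (kseq lam)"
proof -
  have "- (2 * of_nat m) + 2 * of_nat k = (0 :: complex) \<longleftrightarrow> m = k" for k
  proof -
    have "- (2 * of_nat m) + 2 * of_nat k = (0 :: complex) \<longleftrightarrow> (of_nat k :: complex) = of_nat m"
      by auto
    then show ?thesis by (simp only: of_nat_eq_iff eq_commute)
  qed
  then show ?thesis
    unfolding pi_fun_def by (auto simp: prod_list_zero_iff image_iff)
qed

text \<open>\<open>dual_wronskian_eigen\<close> with eigenvalues \<open>- 2 k_j\<close> and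
  \<open>- 2 m\<close>, whose differences multiply to \<open>pi_fun\<close>; the sign in
  \<open>B_num\<close> turns the \<open>htilde\<close> columns into cofactors.\<close>

lemma B_num_A_op_hermite:
  assumes "lam \<noteq> []"
  shows "B_num lam (A_op lam (hermite m)) = smult (pi_fun lam m) (eta lam ^ length lam * hermite m)"
proof -
  let ?l = "length lam" and ?f = "\<lambda>j. hermite (kseq lam ! j)"
  let ?v = "\<lambda>i. (nabla ^^ i) (A_op lam (hermite m))"
  have "bordered ?l (\<lambda>i j. (pderiv ^^ i) (htilde lam j)) ?v =
      bordered ?l (\<lambda>i j. (pderiv ^^ i) (wr (?l - 1) (\<lambda>i. ?f (insert_index j i)))) ?v"
    by (auto simp: bordered_def htilde_eq_wr)
  then have "B_num lam (A_op lam (hermite m)) =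
      det (bordered ?l (\<lambda>i j. (pderiv ^^ i) (wr_cofactor ?l ?f j)) ?v)"
    using det_bordered_signs[of ?l ?f ?v] assms by (simp add: B_num_def)
  also have "\<dots> = smult (\<Prod>j<?l. - 2 * of_nat m - - 2 * of_nat (kseq lam ! j)) (wr ?l ?f ^ ?l * hermite m)"
    unfolding A_op_eq
    by (rule dual_wronskian_eigen) (use assms in \<open>simp_all only: hermite_ode length_greater_0_conv not_False_eq_True\<close>)
  finally show ?thesis
    by (simp only: pi_fun_eq eta_eq_wr)
qed

text \<open>Adding the index turns weak monotonicity into strict monotonicity.\<close>

lemma distinct_kseq:
  assumes "sorted lam"
  shows "distinct (kseq lam)"
proof -
  have "kseq lam ! i < kseq lam ! j" if "i < j" "j < length lam" for i j
    using that sorted_nth_mono[OF assms, of i j] by (simp add: kseq_def)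
  then have "kseq lam ! i \<noteq> kseq lam ! j" if "i \<noteq> j" "i < length lam" "j < length lam" for i j
    using that by (metis linorder_neqE_nat order_less_irrefl)
  then show ?thesis
    by (simp add: distinct_conv_nth)
qed

lemma eta_nonzero:
  assumes "sorted lam"
  shows "eta lam \<noteq> 0"
  unfolding eta_eq_wr
proof (rule wr_nonzero[where \<kappa> = "\<lambda>j. - 2 * of_nat (kseq lam ! j)"])
  show "inj_on (\<lambda>j. - 2 * of_nat (kseq lam ! j) :: complex) {..<length lam}"
    using distinct_kseq[OF assms] by (auto simp: inj_on_def nth_eq_iff_index_eq)
qed (simp_all only: hermite_ode hermite_nonzero not_False_eq_True)

section \<open>Operators with polynomial coefficients and the normal form of
  \<open>BfA\<close>\<close>

lemma diffop_eq_sum: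
  assumes "degree P < N"
  shows "diffop P y = (\<Sum>j<N. coeff P j * (pderiv ^^ j) y)"
  unfolding diffop_def using assms by (intro sum.mono_neutral_left) (auto simp: coeff_eq_0)

text \<open>Closure properties of this predicate yield a normal form without computing any
  coefficients.\<close>

definition is_diffop :: "(complex poly \<Rightarrow> complex poly) \<Rightarrow> bool" where
  "is_diffop E \<longleftrightarrow> (\<exists>P. \<forall>y. E y = diffop P y)"

lemma is_diffop_id: "is_diffop (\<lambda>y. y)"
  unfolding is_diffop_def by (rule exI[of _ 1]) (simp add: diffop_def)

lemma is_diffop_mult:
  assumes "is_diffop E"
  shows "is_diffop (\<lambda>y. p * E y)"
proof -
  obtain P where P: "\<And>y. E y = diffop P y"
    using assms by (auto simp: is_diffop_def)
  have "degree (smult p P) < Suc (degree P)"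
    by (simp add: le_imp_less_Suc degree_smult_le)
  then have "p * E y = diffop (smult p P) y" for y
    by (simp add: P diffop_eq_sum[of _ "Suc (degree P)"] sum_distrib_left mult_ac distrib_left del: sum.lessThan_Suc)
  then show ?thesis
    unfolding is_diffop_def by blast
qed

lemma is_diffop_add:
  assumes "is_diffop E" "is_diffop F"
  shows "is_diffop (\<lambda>y. E y + F y)"
proof -
  obtain P Q where P: "\<And>y. E y = diffop P y" and Q: "\<And>y. F y = diffop Q y"
    using assms by (auto simp: is_diffop_def)
  let ?N = "Suc (max (degree P) (degree Q))"
  have "degree (P + Q) < ?N"
    by (simp add: le_imp_less_Suc degree_add_le_max)
  then have "E y + F y = diffop (P + Q) y" for y
    by (simp add: P Q diffop_eq_sum[of _ ?N] sum.distrib distrib_right del: sum.lessThan_Suc)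
  then show ?thesis
    unfolding is_diffop_def by blast
qed

lemma is_diffop_sum:
  assumes "\<And>j. j \<in> S \<Longrightarrow> is_diffop (E j)"
  shows "is_diffop (\<lambda>y. \<Sum>j\<in>S. E j y)"
proof -
  have zero: "is_diffop (\<lambda>y. 0)"
    using is_diffop_mult[OF is_diffop_id, of 0] by simp
  from assms show ?thesis
    by (induction S rule: infinite_finite_induct) (simp_all add: zero is_diffop_add)
qed

text \<open>Moving the derivative past a coefficient gives \<open>map_poly pderiv P\<close>, and
  raising the order gives \<open>pCons 0 P\<close>.\<close>

lemma is_diffop_pderiv:
  assumes "is_diffop E"
  shows "is_diffop (\<lambda>y. pderiv (E y))"
proof -
  obtain P where P: "\<And>y. E y = diffop P y"
    using assms by (auto simp: is_diffop_def)
  let ?N = "Suc (degree P)"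
  have "pderiv (E y) = diffop (map_poly pderiv P) y + diffop (pCons 0 P) y" for y
  proof -
    have "degree (map_poly pderiv P) < ?N"
      by (simp add: le_imp_less_Suc degree_le coeff_map_poly coeff_eq_0)
    then have "diffop (map_poly pderiv P) y = (\<Sum>j<?N. pderiv (coeff P j) * (pderiv ^^ j) y)"
      by (subst diffop_eq_sum) (simp_all add: coeff_map_poly del: sum.lessThan_Suc)
    moreover have "diffop (pCons 0 P) y = (\<Sum>j<?N. coeff P j * (pderiv ^^ Suc j) y)"
      by (subst diffop_eq_sum[of _ "Suc ?N"])
        (simp_all add: sum.lessThan_Suc_shift[of _ ?N] degree_pCons_eq_if del: sum.lessThan_Suc)
    ultimately show ?thesis
      by (simp add: P diffop_eq_sum[of P ?N] pderiv_sum pderiv_mult sum.distrib mult.commute add.commute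
          del: sum.lessThan_Suc)
  qed
  moreover have "is_diffop (\<lambda>y. diffop Q y)" for Q
    unfolding is_diffop_def by blast
  ultimately show ?thesis
    using is_diffop_add by simp
qed

text \<open>Expansion along the last column gives fixed polynomials times derivatives of
  \<open>y\<close>.\<close>

lemma is_diffop_A_op: "is_diffop (A_op lam)"
proof -
  have "is_diffop (\<lambda>y. (pderiv ^^ i) y)" for i
    by (induction i) (simp_all add: is_diffop_id is_diffop_pderiv)
  then show ?thesis
    unfolding A_op_eq[abs_def] det_bordered[of _ _ "\<lambda>i. (pderiv ^^ i) _"]
    by (intro is_diffop_sum) (subst mult.commute, rule is_diffop_mult)
qed

lemma is_diffop_B_num:
  assumes "is_diffop E"
  shows "is_diffop (\<lambda>y. B_num lam (E y))"
proof -
  have "is_diffop (\<lambda>y. nabla (F y))" if "is_diffop F" for F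
    using is_diffop_add[OF is_diffop_pderiv[OF that] is_diffop_mult[OF that, of "- [:0, 2:]"]]
    by (simp only: nabla_def mult_minus_left diff_conv_add_uminus)
  then have "is_diffop (\<lambda>y. (nabla ^^ i) (E y))" for i
    using assms by (induction i) simp_all
  then show ?thesis
    unfolding B_num_def det_bordered[of _ _ "\<lambda>i. (nabla ^^ i) _"]
    by (intro is_diffop_mult is_diffop_sum) (subst mult.commute, rule is_diffop_mult)
qed

text \<open>On \<open>monom 1 m\<close> the terms above \<open>m\<close> vanish, those below are
  divisible by induction, and the one at \<open>m\<close> is a nonzero constant times the
  coefficient.\<close>

lemma diffop_coeffs_dvd:
  assumes "\<And>y. q dvd diffop R y"
  shows "q dvd coeff R m"
proof (induction m rule: less_induct)
  case (less m)
  let ?D = "\<lambda>j. (pderiv ^^ j) (monom (1 :: complex) m)"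
  have "diffop R (monom 1 m) = (\<Sum>j<Suc (max m (degree R)). coeff R j * ?D j)"
    by (rule diffop_eq_sum) simp
  also have "\<dots> = (\<Sum>j<Suc m. coeff R j * ?D j)"
    by (rule sum.mono_neutral_right) (auto simp: pderiv_funpow_monom)
  also have "\<dots> = (\<Sum>j<m. coeff R j * ?D j) + smult (fact m) (coeff R m)"
    by (simp add: pderiv_funpow_monom monom_0)
  finally have "q dvd (\<Sum>j<m. coeff R j * ?D j) + smult (fact m) (coeff R m)"
    using assms by metis
  moreover have "q dvd (\<Sum>j<m. coeff R j * ?D j)"
    using less by (intro dvd_sum dvd_mult2) auto
  ultimately have "q dvd smult (fact m) (coeff R m)"
    by (simp only: dvd_add_right_iff)
  then show ?case
    by (simp add: dvd_smult_iff)
qed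

lemma BfA_eqI:
  assumes "eta lam \<noteq> 0"
    and "\<And>y. eta lam ^ length lam * diffop P y = B_num lam (f * A_op lam y)"
  shows "BfA lam f = P"
  unfolding BfA_def
proof (rule the_equality)
  have P: "poly (diffop P y) x = B_op lam (poly (f * A_op lam y)) x" if "poly (eta lam) x \<noteq> 0" for y x
    using that unfolding B_op_poly assms(2)[symmetric] by simp
  then show "\<forall>y x. poly (eta lam) x \<noteq> 0 \<longrightarrow> poly (diffop P y) x = B_op lam (poly (f * A_op lam y)) x"
    by blast
  fix Q
  assume Q: "\<forall>y x. poly (eta lam) x \<noteq> 0 \<longrightarrow> poly (diffop Q y) x = B_op lam (poly (f * A_op lam y)) x"
  have "diffop Q = diffop P"
  proof
    fix y
    \<comment> \<open>The factor \<open>eta\<close> extends the agreement to its zeros, so that the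
      polynomials themselves coincide.\<close>
    have "poly (eta lam * diffop Q y) x = poly (eta lam * diffop P y) x" for x
      using P Q by (cases "poly (eta lam) x = 0") auto
    then have "eta lam * diffop Q y = eta lam * diffop P y"
      by (intro poly_ext)
    then show "diffop Q y = diffop P y"
      using assms(1) by simp
  qed
  then show "Q = P" by (rule diffop_inject)
qed

section \<open>Difference operators\<close>

text \<open>
  Asking for all large \<open>N\<close> instead of a fixed support makes finitely supported combinations with
  different supports directly comparable.
\<close>
definition finite_functional :: "((nat \<Rightarrow> complex) \<Rightarrow> complex) \<Rightarrow> bool" where
  "finite_functional \<phi> \<longleftrightarrow> (\<exists>c N0. \<forall>N\<ge>N0. \<forall>g. \<phi> g = (\<Sum>j<N. c j * g j))"

lemma finite_functional_eval: "finite_functional (\<lambda>g. g n)"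
  unfolding finite_functional_def
  by (intro exI[of _ "\<lambda>j. if j = n then 1 else 0"] exI[of _ "Suc n"]) (simp add: if_distrib[of "\<lambda>c. c * _"] cong: if_cong)

lemma finite_functional_mult:
  assumes "finite_functional \<phi>"
  shows "finite_functional (\<lambda>g. a * \<phi> g)"
proof -
  obtain c N0 where c: "\<And>N g. N \<ge> N0 \<Longrightarrow> \<phi> g = (\<Sum>j<N. c j * g j)"
    using assms unfolding finite_functional_def by metis
  show ?thesis
    unfolding finite_functional_def
    by (intro exI[of _ "\<lambda>j. a * c j"] exI[of _ N0]) (simp add: c sum_distrib_left mult.assoc)
qed

lemma finite_functional_add:
  assumes "finite_functional \<phi>" "finite_functional \<psi>"
  shows "finite_functional (\<lambda>g. \<phi> g + \<psi> g)"
proof -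
  obtain c N0 where c: "\<And>N g. N \<ge> N0 \<Longrightarrow> \<phi> g = (\<Sum>j<N. c j * g j)"
    using assms(1) unfolding finite_functional_def by metis
  obtain d N1 where d: "\<And>N g. N \<ge> N1 \<Longrightarrow> \<psi> g = (\<Sum>j<N. d j * g j)"
    using assms(2) unfolding finite_functional_def by metis
  have "\<phi> g + \<psi> g = (\<Sum>j<N. (c j + d j) * g j)" if "N \<ge> max N0 N1" for N g
    using c[of N g] d[of N g] that by (simp add: distrib_right sum.distrib)
  then show ?thesis
    unfolding finite_functional_def
    by (intro exI[of _ "\<lambda>j. c j + d j"] exI[of _ "max N0 N1"]) blast
qed

lemma finite_functional_sum:
  assumes "\<And>j. j \<in> S \<Longrightarrow> finite_functional (\<phi> j)"
  shows "finite_functional (\<lambda>g. \<Sum>j\<in>S. \<phi> j g)"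
proof -
  have zero: "finite_functional (\<lambda>g. 0)"
    using finite_functional_mult[OF finite_functional_eval, of 0] by simp
  from assms show ?thesis
    by (induction S rule: infinite_finite_induct) (simp_all add: zero finite_functional_add)
qed

lemma finite_functional_flat: "finite_functional (\<lambda>g. flat P g n)"
proof -
  have "finite_functional (\<lambda>g. (Delta_op ^^ i) g m)" for i m
  proof (induction i arbitrary: m)
    case (Suc i)
    show ?case
      using finite_functional_add[OF finite_functional_mult[OF Suc[of "m + 1"], of "1 / 2"]
          finite_functional_mult[OF Suc[of "m - 1"], of "of_nat m"]]
      by (simp add: Delta_op_def)
  qed (simp add: finite_functional_eval)
  then have "finite_functional (\<lambda>g. (Gamma_op ^^ j) ((Delta_op ^^ i) g) m)" for j i m
  proof (induction j arbitrary: m)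
    case (Suc j)
    show ?case
      using finite_functional_mult[OF Suc.IH[OF Suc.prems, of "m - 1"], of "2 * of_nat m"]
      by (simp add: Gamma_op_def)
  qed simp
  then show ?thesis
    unfolding flat_def by (intro finite_functional_sum finite_functional_mult)
qed

text \<open>Multiplication by \<open>x\<close> acts on the sequence as \<open>Delta_op\<close> and
  the derivative as \<open>Gamma_op\<close>. Operators in \<open>n\<close> commute with those in
  \<open>x\<close>, hence the reversed order of factors in \<open>flat\<close>.\<close>

lemma flat_hermite: "flat P (\<lambda>m. poly (hermite m) x) m = poly (diffop P (hermite m)) x"
proof -
  have Delta: "(Delta_op ^^ i) (\<lambda>m. poly (hermite m) x) = (\<lambda>m. x ^ i * poly (hermite m) x)" for i
  proof (induction i)
    case (Suc i)
    have "x * poly (hermite m) x = poly (hermite (m + 1)) x / 2 + of_nat m * poly (hermite (m - 1)) x" for m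
      using arg_cong[OF hermite_recurrence[of m], of "\<lambda>p. poly p x"] by (simp del: hermite.simps)
    then have "x ^ Suc i * poly (hermite m) x =
        x ^ i * (poly (hermite (m + 1)) x / 2 + of_nat m * poly (hermite (m - 1)) x)" for m
      by (metis mult.assoc power_Suc2)
    then show ?case
      using Suc by (simp add: Delta_op_def fun_eq_iff algebra_simps)
  qed simp
  have Gamma: "(Gamma_op ^^ j) (\<lambda>m. c * poly (hermite m) x) = (\<lambda>m. c * poly ((pderiv ^^ j) (hermite m)) x)" for c j
  proof (induction j)
    case (Suc j)
    have "(pderiv ^^ Suc j) (hermite m) = smult (2 * of_nat m) ((pderiv ^^ j) (hermite (m - 1)))" for m
      by (simp only: funpow_Suc_right comp_apply pderiv_hermite higher_pderiv_smult)
    then show ?case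
      using Suc by (simp add: Gamma_op_def fun_eq_iff del: funpow.simps) (simp add: Gamma_op_def)
  qed simp
  show ?thesis
    unfolding flat_def diffop_def Delta Gamma
    by (simp add: poly_sum poly_altdef[of "coeff P _"] sum_distrib_right mult.assoc)
qed

section \<open>The stabilizer condition and the eigenvalue equation\<close>

lemma U_space_expand:
  assumes "v \<in> U_space lam"
  shows "\<exists>e N0. (\<forall>j\<in>set (kseq lam). e j = 0) \<and>
    (\<forall>N\<ge>N0. v = (\<Sum>j<N. smult (e j) (A_op lam (hermite j))))"
  using assms unfolding U_space_def
proof (induction v rule: poly_vs.span_induct_alt)
  case base
  show ?case
    by (rule exI[of _ "\<lambda>_. 0"]) simp
next
  case (step c w v)
  \<comment> \<open>\<open>n\<close> is the shifted index, of the Hermite polynomial and not of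
    \<open>hhat\<close>; \<open>index_set\<close> keeps it outside \<open>kseq\<close>.\<close>
  then obtain n where n: "n \<notin> set (kseq lam)" "w = A_op lam (hermite n)"
    by (auto simp: index_set_def hhat_def)
  obtain e N0 where e: "\<forall>j\<in>set (kseq lam). e j = 0"
    and v: "\<And>N. N \<ge> N0 \<Longrightarrow> v = (\<Sum>j<N. smult (e j) (A_op lam (hermite j)))"
    using step.IH by metis
  define e' where "e' j = (if j = n then c else 0) + e j" for j
  have "smult c w + v = (\<Sum>j<N. smult (e' j) (A_op lam (hermite j)))" if "N \<ge> max N0 (Suc n)" for N
  proof -
    have "(\<Sum>j<N. smult (if j = n then c else 0) (A_op lam (hermite j))) =
        (\<Sum>j<N. if j = n then smult c (A_op lam (hermite n)) else 0)"
      by (rule sum.cong) auto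
    also have "\<dots> = smult c w"
      using that n by simp
    finally show ?thesis
      using v[of N] that by (simp add: e'_def smult_add_left sum.distrib)
  qed
  moreover have "\<forall>j\<in>set (kseq lam). e' j = 0"
    using e n by (auto simp: e'_def)
  ultimately show ?case by blast
qed

lemma B_num_stabilizer:
  assumes "lam \<noteq> []"
    and "f * A_op lam (hermite m) = (\<Sum>j<N. smult (e j) (A_op lam (hermite j)))"
  shows "B_num lam (f * A_op lam (hermite m)) =
    eta lam ^ length lam * (\<Sum>j<N. smult (e j * pi_fun lam j) (hermite j))"
  unfolding assms(2)
  by (simp add: B_num_sum B_num_smult B_num_A_op_hermite assms(1) sum_distrib_left)

text \<open>This shows that the \<open>THE\<close> in \<open>BfA\<close> has a witness. Stability
  makes the cleared operator divisible by the power of \<open>eta\<close> on Hermite polynomials,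
  hence on all polynomials, hence in each coefficient.\<close>

lemma BfA_spec:
  assumes "lam \<noteq> []" "sorted lam"
    and stable: "\<And>m. f * A_op lam (hermite m) \<in> U_space lam"
  shows "eta lam ^ length lam * diffop (BfA lam f) y = B_num lam (f * A_op lam y)"
proof -
  let ?q = "eta lam ^ length lam"
  let ?s = "\<lambda>y. B_num lam (f * A_op lam y)"
  have hermite_dvd: "?q dvd ?s (hermite m)" for m
    using U_space_expand[OF stable[of m]] B_num_stabilizer[OF assms(1)] by fastforce
  have dvd: "?q dvd ?s y" for y
  proof -
    obtain c where c: "y = (\<Sum>j<Suc (degree y). smult (c j) (hermite j))"
      using hermite_spans[of y] by blast
    have "?s y = (\<Sum>j<Suc (degree y). smult (c j) (?s (hermite j)))"
      by (subst c) (simp only: A_op_sum A_op_smult sum_distrib_left mult_smult_right B_num_sum B_num_smult)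
    then show ?thesis
      by (simp only: dvd_sum dvd_smult hermite_dvd)
  qed
  obtain R where R: "\<And>y. ?s y = diffop R y"
    using is_diffop_B_num[OF is_diffop_mult[OF is_diffop_A_op]] unfolding is_diffop_def by blast
  have "?q dvd coeff R m" for m
    using diffop_coeffs_dvd[of ?q R m] dvd R by simp
  then obtain P where P: "R = [:?q:] * P"
    using const_poly_dvd_iff[of ?q R] by (auto elim!: dvdE)
  have "?q * diffop P y = ?s y" for y
  proof -
    have "degree (smult ?q P) < Suc (degree P)"
      by (simp add: le_imp_less_Suc degree_smult_le)
    then show ?thesis
      unfolding R P
      by (simp add: diffop_eq_sum[of _ "Suc (degree P)"] sum_distrib_left mult_ac del: sum.lessThan_Suc)
  qed
  moreover from this have "BfA lam f = P"
    by (intro BfA_eqI eta_nonzero assms)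
  ultimately show ?thesis by simp
qed

theorem theorem8:
  fixes lam :: "nat list" and f :: "complex poly" and n :: nat and x :: complex
  assumes "lam \<noteq> []" and "sorted lam" and "\<forall>a\<in>set lam. 0 < a"
    and "f \<in> stabilizer lam"
    and "sum_list lam - length lam \<le> n"
  shows "Delta_hat lam f (\<lambda>m. poly (hhat lam m) x) n = poly f x * poly (hhat lam n) x"
proof -
  let ?d = "sum_list lam - length lam"
  \<comment> \<open>Positive parts ensure that the natural subtractions in the shift do not
    truncate.\<close>
  have "length lam \<le> sum_list lam"
    using assms(3) by (induction lam) (auto simp: Suc_le_eq intro: add_less_le_mono)
  then have hhat: "hhat lam (m + ?d) = A_op lam (hermite m)" for m
    by (simp add: hhat_def)
  define m where "m = n - ?d"
  have n: "n = m + ?d"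
    using assms(5) by (simp add: m_def)
  let ?a = "\<lambda>j. poly (A_op lam (hermite j)) x"
  have stable: "f * A_op lam (hermite k) \<in> U_space lam" for k
    using assms(4) hhat[of k] unfolding stabilizer_def by (metis (mono_tags, lifting) le_add2 mem_Collect_eq)
  obtain e N0 where e: "\<And>j. j \<in> set (kseq lam) \<Longrightarrow> e j = 0"
    and e_sum: "\<And>N. N \<ge> N0 \<Longrightarrow> f * A_op lam (hermite m) = (\<Sum>j<N. smult (e j) (A_op lam (hermite j)))"
    using U_space_expand[OF stable[of m]] by metis
  obtain c N1 where c: "\<And>N g. N \<ge> N1 \<Longrightarrow> flat (BfA lam f) g m = (\<Sum>j<N. c j * g j)"
    using finite_functional_flat[of "BfA lam f" m] unfolding finite_functional_def by metis
  \<comment> \<open>One bound beyond both supports lets the two expansions be compared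
    termwise.\<close>
  define N where "N = max N0 N1"
  have "eta lam ^ length lam * diffop (BfA lam f) (hermite m) =
      eta lam ^ length lam * (\<Sum>j<N. smult (e j * pi_fun lam j) (hermite j))"
    unfolding BfA_spec[OF assms(1,2) stable]
    by (rule B_num_stabilizer[OF assms(1) e_sum]) (simp add: N_def)
  then have diffop: "diffop (BfA lam f) (hermite m) = (\<Sum>j<N. smult (e j * pi_fun lam j) (hermite j))"
    using eta_nonzero[OF assms(2)] by simp
  \<comment> \<open>The coefficients \<open>c\<close> do not depend on the sequence, so testing on
    Hermite values at every \<open>z\<close> determines them.\<close>
  have "poly (\<Sum>j<N. smult (c j) (hermite j)) z = poly (\<Sum>j<N. smult (e j * pi_fun lam j) (hermite j)) z" for z
    using flat_hermite[of "BfA lam f" z m] c[of N "\<lambda>j. poly (hermite j) z"]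
    by (simp add: diffop poly_sum N_def)
  then have "(\<Sum>j<N. smult (c j - e j * pi_fun lam j) (hermite j)) = 0"
    by (simp add: smult_diff_left sum_subtractf poly_eq_poly_eq_iff[symmetric] fun_eq_iff)
  then have c_eq: "c j = e j * pi_fun lam j" if "j < N" for j
    using hermite_independent that by fastforce
  have "Delta_hat lam f (\<lambda>m. poly (hhat lam m) x) n = flat (BfA lam f) (\<lambda>j. 1 / pi_fun lam j * ?a j) m"
    by (simp add: Delta_hat_def Let_def comp_def shift_back_def shift_fwd_def[abs_def] hhat m_def)
  also have "\<dots> = (\<Sum>j<N. c j * (1 / pi_fun lam j * ?a j))"
    by (rule c) (simp add: N_def)
  \<comment> \<open>Outside \<open>kseq\<close> the factor \<open>pi_fun\<close> cancels; on
    \<open>kseq\<close> both sides are zero because \<open>e j = 0\<close>.\<close>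
  also have "\<dots> = (\<Sum>j<N. e j * ?a j)"
    by (rule sum.cong) (auto simp: c_eq e pi_fun_eq_0_iff)
  also have "\<dots> = poly (f * A_op lam (hermite m)) x"
    by (subst e_sum[of N]) (simp_all add: N_def poly_sum)
  finally show ?thesis
    by (simp only: poly_mult n hhat)
qed

end
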